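(* Let $G$ be a non-complete graph. (i) If $\chi(G)\ge 3$ and $\chi(D(G))=\chi(G)$, then $\mathrm{st}(n,G)=(1+o(1))\,\mathrm{ex}(n,K_{\chi(G)})$ as $n\to\infty$. (ii) If $\chi(D(G))=\chi(G)+1$, then $G$ is a complete $\chi(G)$-partite graph and $\mathrm{st}(n,G)=\mathrm{ex}(n,K_{\chi(G)+1})$ for every sufficiently large $n$. (iii) If $\chi(G)=2$ and $\chi(D(G))=2$, then $\mathrm{st}(n,G)\le \mathrm{ex}(n,H)$ where $H$ is any complete bipartite graph on $|G|$ vertices containing $G$ as a spanning non-induced (i.e. proper) subgraph, and $\mathrm{st}(n,G)$ is sub-quadratic, i.e. $\mathrm{st}(n,G)=o(n^2)$.
   Context: Graphs are finite and simple; $|G|$ is the number of vertices of $G$, $\chi$ is the chromatic number. "Contains" refers to not necessarily induced subgraphs. $\mathrm{ex}(n,G)$ is the maximum number of edges of a graph on $n$ vertices containing no copy of $G$. For a non-complete graph $G$ on $k$ vertices and $n\ge k$, $\mathrm{st}(n,G)$ is the largest $m$ for which there is a graph $H$ with $n$ vertices and $m$ edges such that no subgraph $F\subseteq H$ on exactly $k$ vertices contains $G$ as a proper subgraph. $D(G)$ is the family of all graphs $H$ with $|H|=|G|$ obtained from $G$ by adding one new edge between two non-adjacent vertices, and $\chi(D(G))=\min\{\chi(H):H\in D(G)\}$. A complete 1-partite graph is an edgeless graph. *)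

theory Defs
  imports Complex_Main "HOL-Library.Landau_Symbols" "HOL-Library.Disjoint_Sets"
begin

text \<open>A graph is a pair of a vertex set and a set of edges, each edge being a two-element vertex set.\<close>

type_synonym 'a graph = "'a set \<times> 'a set set"

abbreviation verts :: "'a graph \<Rightarrow> 'a set" where "verts \<equiv> fst"

abbreviation edges :: "'a graph \<Rightarrow> 'a set set" where "edges \<equiv> snd"

definition simple_graph :: "'a graph \<Rightarrow> bool" where
  "simple_graph G \<longleftrightarrow> finite (verts G) \<and> (\<forall>e\<in>edges G. e \<subseteq> verts G \<and> card e = 2)"

definition complete_graph :: "'a graph \<Rightarrow> bool" where
  "complete_graph G \<longleftrightarrow> (\<forall>u\<in>verts G. \<forall>v\<in>verts G. u \<noteq> v \<longrightarrow> {u, v} \<in> edges G)"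

definition complete_graph_on :: "nat \<Rightarrow> nat graph" where
  "complete_graph_on r = ({..<r}, {{u, v} | u v. u < r \<and> v < r \<and> u \<noteq> v})"

definition subgraph :: "'a graph \<Rightarrow> 'a graph \<Rightarrow> bool" where
  "subgraph F H \<longleftrightarrow> simple_graph F \<and> verts F \<subseteq> verts H \<and> edges F \<subseteq> edges H"

definition graph_iso :: "'a graph \<Rightarrow> 'b graph \<Rightarrow> bool" where
  "graph_iso G H \<longleftrightarrow> (\<exists>f. bij_betw f (verts G) (verts H) \<and> (\<lambda>e. f ` e) ` edges G = edges H)"

text \<open>Containment is up to isomorphism and not necessarily induced.\<close>

definition contains :: "'b graph \<Rightarrow> 'a graph \<Rightarrow> bool" where
  "contains H G \<longleftrightarrow> (\<exists>G'. subgraph G' H \<and> graph_iso G G')"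

definition contains_proper :: "'b graph \<Rightarrow> 'a graph \<Rightarrow> bool" where
  "contains_proper H G \<longleftrightarrow> (\<exists>G'. subgraph G' H \<and> G' \<noteq> H \<and> graph_iso G G')"

definition colourable :: "nat \<Rightarrow> 'a graph \<Rightarrow> bool" where
  "colourable r G \<longleftrightarrow> (\<exists>c :: 'a \<Rightarrow> nat. c ` verts G \<subseteq> {..<r} \<and>
     (\<forall>u v. {u, v} \<in> edges G \<and> u \<noteq> v \<longrightarrow> c u \<noteq> c v))"

definition chromatic_number :: "'a graph \<Rightarrow> nat" where
  "chromatic_number G = (LEAST r. colourable r G)"

text \<open>The parts of a complete multipartite graph are non-empty, as required by \<open>partition_on\<close>.\<close>

definition complete_partite :: "nat \<Rightarrow> 'a graph \<Rightarrow> bool" where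
  "complete_partite r G \<longleftrightarrow> (\<exists>P. partition_on (verts G) P \<and> card P = r \<and>
     edges G = {{u, v} | u v. \<exists>A\<in>P. \<exists>B\<in>P. A \<noteq> B \<and> u \<in> A \<and> v \<in> B})"

definition one_edge_extensions :: "'a graph \<Rightarrow> 'a graph set" where
  "one_edge_extensions G = {(verts G, insert {u, v} (edges G)) | u v.
     u \<in> verts G \<and> v \<in> verts G \<and> u \<noteq> v \<and> {u, v} \<notin> edges G}"

definition chromatic_number_D :: "'a graph \<Rightarrow> nat" where
  "chromatic_number_D G = Min (chromatic_number ` one_edge_extensions G)"

text \<open>
  Host graphs have natural numbers as vertices, which is no restriction up to isomorphism.
  Both sets below are finite, as the host has at most \<open>n choose 2\<close> edges. The edgeless host
  shows that the first is non-empty if \<open>G\<close> has an edge, and that the second always is.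
\<close>

definition ex :: "nat \<Rightarrow> 'a graph \<Rightarrow> nat" where
  "ex n G = Max {card (edges H) | H :: nat graph.
     simple_graph H \<and> card (verts H) = n \<and> \<not> contains H G}"

definition st :: "nat \<Rightarrow> 'a graph \<Rightarrow> nat" where
  "st n G = Max {card (edges H) | H :: nat graph.
     simple_graph H \<and> card (verts H) = n \<and>
     \<not> (\<exists>F. subgraph F H \<and> card (verts F) = card (verts G) \<and> contains_proper F G)}"

end

theory Submission
  imports Defs
begin

text \<open>
  A host graph counts for \<open>st n G\<close> iff it contains no member of \<open>D(G)\<close>, so \<open>st n G\<close> is the extremal
  number of the finite family \<open>D(G)\<close>. Let \<open>t(r, n)\<close> denote the largest number of edges of an
  \<open>r\<close>-colourable graph on \<open>n\<close> vertices (\<open>turan r n\<close> below).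

  If \<open>\<chi>(D(G)) = r + 1\<close>, then an \<open>r\<close>-colourable host contains no member of \<open>D(G)\<close> and no complete
  graph on \<open>r + 1\<close> vertices, so \<open>t(r, n)\<close> is a lower bound for both \<open>st n G\<close> and
  \<open>ex(n, K\<^sub>r\<^sub>+\<^sub>1)\<close>. Some member of \<open>D(G)\<close> is a subgraph of a blow-up of the complete graph on \<open>r + 1\<close>
  vertices, and so is the complete graph itself; the theorem of Erdos and Stone (\<open>erdos_stone\<close>)
  bounds both quantities from above by \<open>(1 - 1/r + o(1)) n\<^sup>2/2\<close>, which is also the asymptotic lower
  bound for \<open>t(r, n)\<close> (\<open>turan_lower_bound\<close>). For \<open>r \<ge> 2\<close> this gives the asymptotic equivalence,
  and for \<open>r = 1\<close> it gives \<open>st n G = o(n\<^sup>2)\<close>.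

  Erdos-Stone is proved by induction on \<open>r\<close>. A large graph with density at least \<open>1 - 1/r\<close> contains a
  blow-up \<open>S\<close> of the complete graph on \<open>r\<close> vertices with large parts. By the pigeonhole principle
  only boundedly many vertices have many neighbours in all parts of \<open>S\<close>, so that the removal of
  \<open>S\<close> destroys only about \<open>(1 - 1/r) |S|\<close> edges per remaining vertex. Iterating the removal gives
  the bound.

  If \<open>\<chi>(D(G)) = \<chi>(G) + 1\<close>, then in a colouring of \<open>G\<close> with \<open>r = \<chi>(G)\<close> colours all pairs of different
  colours are edges, as an additional edge between different colours would keep the colouring proper.
  Hence \<open>G\<close> is complete \<open>r\<close>-partite, and both a member of \<open>D(G)\<close> and the complete graph on \<open>r + 1\<close> vertices are subgraphs of
  a complete \<open>r\<close>-partite graph plus an edge inside a part. Large graphs without the latter have at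
  most \<open>t(r, n)\<close> edges (\<open>card_edges_le_turan_if_not_critical\<close>): the removal of a blow-up
  of the complete graph on \<open>r\<close> vertices lets the excess over \<open>t(r, n)\<close> decrease unless the graph is
  \<open>r\<close>-colourable. So both numbers equal \<open>t(r, n)\<close> for large \<open>n\<close>; for the complete graph this is
  Turan's theorem for large \<open>n\<close>.

  The inequality \<open>st n G \<le> ex n H\<close> is immediate: a copy of \<open>H\<close> is a subgraph on \<open>|G|\<close> vertices
  that contains \<open>G\<close> properly.
\<close>

section \<open>Counting edges\<close>

lemma edge_in_verts:
  assumes "simple_graph H" "{u, v} \<in> edges H"
  shows "u \<in> verts H" "v \<in> verts H" "u \<noteq> v"
proof -
  have "{u, v} \<subseteq> verts H" "card {u, v} = 2" using assms unfolding simple_graph_def by blast+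
  then show "u \<in> verts H" "v \<in> verts H" "u \<noteq> v" by auto
qed

lemma edge_cases:
  assumes "simple_graph H" "e \<in> edges H"
  obtains u v where "e = {u, v}" "u \<noteq> v" "u \<in> verts H" "v \<in> verts H"
proof -
  from assms have e: "e \<subseteq> verts H" "card e = 2" by (auto simp: simple_graph_def)
  then obtain u v where "e = {u, v}" "u \<noteq> v" by (auto simp: card_2_iff)
  with e show ?thesis using that by blast
qed

lemma finite_edges: "simple_graph H \<Longrightarrow> finite (edges H)"
  unfolding simple_graph_def by (rule finite_subset[of _ "Pow (verts H)"]) auto

text \<open>The edges inside \<open>A\<close>, those inside \<open>S\<close>, and those between \<open>A\<close> and \<open>S\<close>.\<close>

lemma edges_split:
  assumes H: "simple_graph H" and V: "verts H = A \<union> S" and AS: "A \<inter> S = {}"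
  shows "card (edges H) = card {e \<in> edges H. e \<subseteq> A} + card {e \<in> edges H. e \<subseteq> S}
    + (\<Sum>v\<in>A. card {u \<in> S. {u, v} \<in> edges H})"
proof -
  let ?X = "{e \<in> edges H. e \<subseteq> A}" and ?Y = "{e \<in> edges H. e \<subseteq> S}"
  let ?N = "\<lambda>v. {u \<in> S. {u, v} \<in> edges H}"
  let ?Z = "\<Union>v\<in>A. (\<lambda>u. {u, v}) ` ?N v"
  have fin: "finite A" "finite S" using H V by (auto simp: simple_graph_def)
  have E: "edges H = (?X \<union> ?Y) \<union> ?Z"
  proof
    show "edges H \<subseteq> (?X \<union> ?Y) \<union> ?Z"
    proof
      fix e assume e: "e \<in> edges H"
      then obtain u v where uv: "e = {u, v}" "u \<in> A \<union> S" "v \<in> A \<union> S"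
        using edge_cases[OF H e] V by metis
      have Z: "{a, b} \<in> ?Z" if "{a, b} \<in> edges H" "a \<in> S" "b \<in> A" for a b
        using that by blast
      consider "u \<in> A" "v \<in> A" | "u \<in> S" "v \<in> S" | "u \<in> S" "v \<in> A" | "v \<in> S" "u \<in> A"
        using uv by blast
      then show "e \<in> (?X \<union> ?Y) \<union> ?Z"
      proof cases
        case 3
        then show ?thesis using Z[of u v] e uv(1) by (intro UnI2) simp
      next
        case 4
        moreover have "e = {v, u}" using uv by blast
        ultimately show ?thesis using Z[of v u] e by (intro UnI2) simp
      qed (use e uv in auto)
    qed
  qed auto
  have XY: "?X \<inter> ?Y = {}"
  proof -
    have False if "e \<in> edges H" "e \<subseteq> A" "e \<subseteq> S" for e
    proof -
      have "e = {}" using that AS by blast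
      with that H show False by (auto simp: simple_graph_def)
    qed
    then show ?thesis by blast
  qed
  have XYZ: "(?X \<union> ?Y) \<inter> ?Z = {}" using AS by auto
  have "card ?Z = (\<Sum>v\<in>A. card ((\<lambda>u. {u, v}) ` ?N v))"
  proof (rule card_UN_disjoint)
    show "\<forall>i\<in>A. \<forall>j\<in>A. i \<noteq> j \<longrightarrow> (\<lambda>u. {u, i}) ` ?N i \<inter> (\<lambda>u. {u, j}) ` ?N j = {}"
      using AS by (auto simp: doubleton_eq_iff)
  qed (use fin in auto)
  also have "\<dots> = (\<Sum>v\<in>A. card (?N v))"
    by (intro sum.cong refl card_image) (auto simp: inj_on_def doubleton_eq_iff)
  finally have Z: "card ?Z = (\<Sum>v\<in>A. card (?N v))" .
  have fX: "finite ?X" "finite ?Y" "finite ?Z" using fin finite_edges[OF H] by auto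
  have "card (edges H) = card ((?X \<union> ?Y) \<union> ?Z)" by (rule arg_cong[OF E])
  also have "\<dots> = card ?X + card ?Y + card ?Z"
    using fX XY XYZ by (simp add: card_Un_disjoint)
  finally show ?thesis using Z by simp
qed

lemma handshake:
  assumes H: "simple_graph H"
  shows "(\<Sum>v\<in>verts H. card {u \<in> verts H. {u, v} \<in> edges H}) = 2 * card (edges H)"
proof -
  have "card {u \<in> verts H. {u, v} \<in> edges H} = card {e \<in> edges H. v \<in> e}" for v
  proof (rule bij_betw_same_card)
    show "bij_betw (\<lambda>u. {u, v}) {u \<in> verts H. {u, v} \<in> edges H} {e \<in> edges H. v \<in> e}"
    proof (rule bij_betwI')
      fix e assume "e \<in> {e \<in> edges H. v \<in> e}"
      then have e: "e \<in> edges H" "v \<in> e" by auto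
      then obtain a b where "e = {a, b}" "a \<in> verts H" "b \<in> verts H"
        using edge_cases[OF H] by metis
      with e obtain u where "e = {u, v}" "u \<in> verts H" by blast
      with e show "\<exists>u\<in>{u \<in> verts H. {u, v} \<in> edges H}. e = {u, v}" by blast
    qed (auto simp: doubleton_eq_iff)
  qed
  then have "(\<Sum>v\<in>verts H. card {u \<in> verts H. {u, v} \<in> edges H})
    = (\<Sum>v\<in>verts H. card {e \<in> edges H. v \<in> e})" by simp
  also have "\<dots> = 2 * card (edges H)"
  proof (rule sum_multicount)
    show "\<forall>e\<in>edges H. card {v \<in> verts H. v \<in> e} = 2"
    proof
      fix e assume "e \<in> edges H"
      then have e: "e \<subseteq> verts H" "card e = 2" using H by (auto simp: simple_graph_def)
      then have "{v \<in> verts H. v \<in> e} = e" by auto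
      with e show "card {v \<in> verts H. v \<in> e} = 2" by simp
    qed
  qed (use H finite_edges[OF H] in \<open>auto simp: simple_graph_def\<close>)
  finally show ?thesis .
qed

text \<open>The subgraph of \<open>H\<close> induced by the vertex set \<open>A\<close>.\<close>

definition induced :: "'b graph \<Rightarrow> 'b set \<Rightarrow> 'b graph" where
  "induced H A = (A, {e \<in> edges H. e \<subseteq> A})"

lemma induced_simps [simp]: "verts (induced H A) = A" "edges (induced H A) = {e \<in> edges H. e \<subseteq> A}"
  by (simp_all add: induced_def)

lemma subgraph_induced:
  assumes "simple_graph H" "A \<subseteq> verts H"
  shows "subgraph (induced H A) H"
  using assms by (auto simp: subgraph_def simple_graph_def intro: finite_subset)

lemma simple_induced: "simple_graph H \<Longrightarrow> A \<subseteq> verts H \<Longrightarrow> simple_graph (induced H A)"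
  using subgraph_induced[of H A] unfolding subgraph_def by blast

lemma card_edges_le_of_degree:
  assumes H: "simple_graph H" and d: "\<And>v. v \<in> verts H \<Longrightarrow> card {u \<in> verts H. {u, v} \<in> edges H} \<le> d"
  shows "2 * card (edges H) \<le> card (verts H) * d"
  using handshake[OF H] sum_bounded_above[of "verts H" "\<lambda>v. card {u \<in> verts H. {u, v} \<in> edges H}" d] d
  by simp

lemma card_edges_le_square:
  assumes H: "simple_graph H"
  shows "card (edges H) \<le> card (verts H) * card (verts H)"
proof -
  have "finite (verts H)" using H by (simp add: simple_graph_def)
  then have "card {u \<in> verts H. {u, v} \<in> edges H} \<le> card (verts H)" for v
    by (intro card_mono) auto
  then show ?thesis using card_edges_le_of_degree[OF H, of "card (verts H)"] by simp
qed

section \<open>Extremal multipartite graphs\<close>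

text \<open>The complete multipartite graph on \<open>V\<close> whose parts are the colour classes of \<open>c\<close>.\<close>

definition partite_graph :: "'b set \<Rightarrow> ('b \<Rightarrow> nat) \<Rightarrow> 'b graph" where
  "partite_graph V c = (V, {{u, v} | u v. u \<in> V \<and> v \<in> V \<and> c u \<noteq> c v})"

text \<open>
  The largest number of edges of an \<open>r\<close>-colourable graph on \<open>n\<close> vertices, which is the number of
  edges of the \<open>r\<close>-partite Turan graph. Taking the maximum over all colourings makes the upper
  bound for \<open>r\<close>-colourable graphs immediate, and no optimal colouring has to be determined.
\<close>

definition turan :: "nat \<Rightarrow> nat \<Rightarrow> nat" where
  "turan r n = Max {card (edges (partite_graph {..<n} c)) | c. c ` {..<n} \<subseteq> {..<r}}"

lemma verts_partite_graph [simp]: "verts (partite_graph V c) = V"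
  by (simp add: partite_graph_def)

lemma edge_partite_graph_iff:
  "{u, v} \<in> edges (partite_graph V c) \<longleftrightarrow> u \<in> V \<and> v \<in> V \<and> c u \<noteq> c v"
  by (auto simp: partite_graph_def doubleton_eq_iff)

lemma simple_partite_graph: "finite V \<Longrightarrow> simple_graph (partite_graph V c)"
  by (auto simp: simple_graph_def partite_graph_def card_insert_if)

lemma finite_turan_set:
  fixes n r :: nat
  shows "finite {card (edges (partite_graph {..<n} c)) | c. c ` {..<n} \<subseteq> {..<r}}"
proof (rule finite_subset[of _ "{..n * n}"])
  show "{card (edges (partite_graph {..<n} c)) | c. c ` {..<n} \<subseteq> {..<r}} \<subseteq> {..n * n}"
    using card_edges_le_square[OF simple_partite_graph[of "{..<n}"]] by auto
qed simp

lemma turan_attained: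
  assumes "1 \<le> r"
  obtains c where "c ` {..<n} \<subseteq> {..<r}" "turan r n = card (edges (partite_graph {..<n} c))"
proof -
  have "(\<lambda>_. 0) ` {..<n} \<subseteq> {..<r}" using assms by auto
  then have "{card (edges (partite_graph {..<n} c)) | c. c ` {..<n} \<subseteq> {..<r}} \<noteq> {}"
    by blast
  from Max_in[OF finite_turan_set this] show ?thesis
    using that by (auto simp: turan_def)
qed

lemma card_partite_graph_le_turan:
  "c ` {..<n} \<subseteq> {..<r} \<Longrightarrow> card (edges (partite_graph {..<n} c)) \<le> turan r n"
  unfolding turan_def by (rule Max_ge[OF finite_turan_set]) auto

lemma card_edges_le_turan:
  assumes H: "simple_graph H" and c: "c ` verts H \<subseteq> {..<r}"
    and proper: "\<And>u v. {u, v} \<in> edges H \<Longrightarrow> c u \<noteq> c v"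
  shows "card (edges H) \<le> turan r (card (verts H))"
proof -
  let ?n = "card (verts H)"
  obtain h where h: "bij_betw h {..<?n} (verts H)"
    using H ex_bij_betw_nat_finite[of "verts H"]
    by (auto simp: simple_graph_def atLeast0LessThan)
  let ?P = "partite_graph {..<?n} (c \<circ> h)"
  have "edges H \<subseteq> (\<lambda>e. h ` e) ` edges ?P"
  proof
    fix e assume e: "e \<in> edges H"
    then obtain u v where uv: "e = {u, v}" "u \<in> verts H" "v \<in> verts H"
      using edge_cases[OF H] by metis
    have "h ` {..<?n} = verts H" using h by (simp add: bij_betw_def)
    with uv have "u \<in> h ` {..<?n}" "v \<in> h ` {..<?n}" by auto
    then obtain i j where ij: "i < ?n" "j < ?n" "u = h i" "v = h j" by (elim imageE) simp
    with e uv proper have "{i, j} \<in> edges ?P" by (simp add: edge_partite_graph_iff)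
    then show "e \<in> (\<lambda>e. h ` e) ` edges ?P" using uv ij by (intro image_eqI[of _ _ "{i, j}"]) auto
  qed
  then have "card (edges H) \<le> card (edges ?P)"
    by (rule surj_card_le[rotated]) (simp add: finite_edges simple_partite_graph)
  also have "\<dots> \<le> turan r ?n"
    using c h by (intro card_partite_graph_le_turan) (auto simp: bij_betw_def)
  finally show ?thesis .
qed

text \<open>
  Adding \<open>s\<close> new vertices to each of the \<open>r\<close> parts of an optimal graph. All counts are doubled,
  since \<open>r (r - 1) s\<^sup>2\<close> is twice the number of edges among the new vertices.
\<close>

lemma turan_step:
  assumes r: "1 \<le> r"
  shows "2 * turan r n + r * s * ((r - 1) * s) + 2 * (n * ((r - 1) * s)) \<le> 2 * turan r (n + r * s)"
proof (cases "s = 0")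
  case False
  obtain c where c: "c ` {..<n} \<subseteq> {..<r}" "turan r n = card (edges (partite_graph {..<n} c))"
    using turan_attained[OF r] .
  \<comment> \<open>The new vertices are coloured in \<open>r\<close> consecutive blocks of length \<open>s\<close>.\<close>
  define c' where "c' i = (if i < n then c i else (i - n) div s)" for i
  let ?m = "n + r * s"
  let ?P = "partite_graph {..<?m} c'"
  let ?S = "{n..<?m}"
  have simpleP: "simple_graph ?P" by (simp add: simple_partite_graph)
  have outside: "card {u \<in> ?S. c' u \<noteq> i} = (r - 1) * s" if i: "i < r" for i
  proof -
    have isr: "i * s + s \<le> r * s"
      using i mult_le_mono1[of "Suc i" r s] by simp
    have "{u \<in> ?S. c' u = i} = {n + i * s..<n + i * s + s}"
    proof (intro set_eqI iffI)
      fix u assume "u \<in> {u \<in> ?S. c' u = i}"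
      then have u: "n \<le> u" "(u - n) div s = i" by (auto simp: c'_def)
      have "i * s \<le> u - n \<and> u - n < i * s + s"
        using u False div_times_less_eq_dividend[of "u - n" s] dividend_less_div_times[of s "u - n"]
        by auto
      with u(1) show "u \<in> {n + i * s..<n + i * s + s}"
        unfolding atLeastLessThan_iff by linarith
    next
      fix u assume u: "u \<in> {n + i * s..<n + i * s + s}"
      then have "(u - n) div s = i" by (intro div_nat_eqI) (auto simp: mult.commute[of s i])
      with u isr show "u \<in> {u \<in> ?S. c' u = i}" by (auto simp: c'_def)
    qed
    then have "card {u \<in> ?S. c' u = i} = s" by simp
    moreover have "card {u \<in> ?S. c' u \<noteq> i} = card (?S - {u \<in> ?S. c' u = i})"
      by (rule arg_cong[of _ _ card]) auto
    moreover have "\<dots> = card ?S - card {u \<in> ?S. c' u = i}"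
      by (rule card_Diff_subset) auto
    ultimately show ?thesis by (simp add: diff_mult_distrib)
  qed
  have c'r: "c' i < r" if "i < ?m" for i
    using that c False by (auto simp: c'_def less_mult_imp_div_less)
  have "card {e \<in> edges ?P. e \<subseteq> {..<n}} = card (edges (partite_graph {..<n} c))"
    by (rule arg_cong[of _ _ card]) (auto simp: partite_graph_def c'_def; force)
  moreover have "2 * card {e \<in> edges ?P. e \<subseteq> ?S} = r * s * ((r - 1) * s)"
  proof -
    have "simple_graph (induced ?P ?S)"
      by (rule simple_induced[OF simpleP]) auto
    from handshake[OF this]
    have "2 * card {e \<in> edges ?P. e \<subseteq> ?S} = (\<Sum>v\<in>?S. card {u \<in> ?S. {u, v} \<in> edges ?P})"
      by (simp add: conj_commute cong: conj_cong)
    also have "\<dots> = (\<Sum>v\<in>?S. (r - 1) * s)"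
    proof (rule sum.cong)
      fix v assume v: "v \<in> ?S"
      have "{u \<in> ?S. {u, v} \<in> edges ?P} = {u \<in> ?S. c' u \<noteq> c' v}"
        using v by (auto simp: edge_partite_graph_iff)
      then show "card {u \<in> ?S. {u, v} \<in> edges ?P} = (r - 1) * s"
        using outside[of "c' v"] c'r v by simp
    qed simp
    finally show ?thesis by simp
  qed
  moreover have "(\<Sum>v<n. card {u \<in> ?S. {u, v} \<in> edges ?P}) = n * ((r - 1) * s)"
  proof -
    have "card {u \<in> ?S. {u, v} \<in> edges ?P} = (r - 1) * s" if v: "v < n" for v
    proof -
      have "{u \<in> ?S. {u, v} \<in> edges ?P} = {u \<in> ?S. c' u \<noteq> c' v}"
        using v by (auto simp: edge_partite_graph_iff)
      then show ?thesis using outside[of "c' v"] c'r v by simp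
    qed
    then show ?thesis by simp
  qed
  moreover have "card (edges ?P) \<le> turan r ?m"
    using c'r by (intro card_partite_graph_le_turan) auto
  moreover have "card (edges ?P) = card {e \<in> edges ?P. e \<subseteq> {..<n}} + card {e \<in> edges ?P. e \<subseteq> ?S}
    + (\<Sum>v<n. card {u \<in> ?S. {u, v} \<in> edges ?P})"
    by (rule edges_split[OF simpleP]) auto
  ultimately show ?thesis using c(2) by linarith
qed simp

text \<open>
  The bound comes from \<open>r\<close> parts of size \<open>n div r\<close>; the linear term absorbs the rounding.
\<close>

lemma turan_lower_bound:
  assumes r: "1 \<le> r"
  shows "(1 - 1 / real r) * (real n)\<^sup>2 / 2 - real r * real n \<le> real (turan r n)"
proof -
  define s where "s = n div r"
  have n: "n = n mod r + r * s" by (simp add: s_def)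
  have "r * s * ((r - 1) * s) \<le> 2 * turan r n"
    using turan_step[OF r, of "n mod r" s] n by simp
  then have le: "real r * s * ((real r - 1) * s) \<le> 2 * real (turan r n)"
  proof -
    have "real (r * s * ((r - 1) * s)) \<le> real (2 * turan r n)"
      using \<open>_ \<le> 2 * turan r n\<close> by (simp only: of_nat_le_iff)
    then show ?thesis using r by (simp add: of_nat_diff)
  qed
  have rs: "real n - real r \<le> real r * s"
  proof -
    have "n \<le> r + r * s" using n r mod_less_divisor[of r n] by linarith
    then have "real n \<le> real (r + r * s)" by (simp only: of_nat_le_iff)
    then show ?thesis by simp
  qed
  have sq: "(real n)\<^sup>2 - 2 * (real r * real n) \<le> (real r * s)\<^sup>2"
  proof (cases "real n \<ge> real r")
    case True
    then have "(real n - real r)\<^sup>2 \<le> (real r * s)\<^sup>2" using rs by (intro power_mono) auto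
    moreover have "(real n - real r)\<^sup>2 = (real n)\<^sup>2 - 2 * (real r * real n) + (real r)\<^sup>2"
      by (simp add: power2_eq_square algebra_simps)
    ultimately show ?thesis using zero_le_power2[of "real r"] by linarith
  next
    case False
    then have "real n * real n \<le> (2 * real r) * real n" by (intro mult_right_mono) auto
    then show ?thesis using zero_le_power2[of "real r * s"] unfolding power2_eq_square by linarith
  qed
  have "(1 - 1 / real r) * ((real n)\<^sup>2 - 2 * (real r * real n)) \<le> (1 - 1 / real r) * (real r * s)\<^sup>2"
    using r by (intro mult_left_mono sq) auto
  also have "\<dots> = real r * s * ((real r - 1) * s)" using r by (simp add: field_simps power2_eq_square)
  finally have *: "(1 - 1 / real r) * ((real n)\<^sup>2 - 2 * (real r * real n)) \<le> 2 * real (turan r n)"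
    using le by linarith
  have "(1 - 1 / real r) * (2 * (real r * real n)) \<le> 2 * (real r * real n)"
    using mult_right_mono[of "1 - 1 / real r" 1 "2 * (real r * real n)"] r by simp
  moreover have "(1 - 1 / real r) * (real n)\<^sup>2 - (1 - 1 / real r) * (2 * (real r * real n))
    \<le> 2 * real (turan r n)"
    using * by (simp only: right_diff_distrib)
  moreover have "a * X / 2 - Y \<le> T" if "a * (2 * Y) \<le> 2 * Y" "a * X - a * (2 * Y) \<le> 2 * T"
    for a X Y T :: real
    using that by linarith
  ultimately show ?thesis by blast
qed

section \<open>Blow-ups of complete graphs\<close>

text \<open>
  The sets \<open>S 0, \<dots>, S (r - 1)\<close> are parts of a complete \<open>r\<close>-partite subgraph of \<open>H\<close>.
  If \<open>H\<close> is simple, disjointness of the parts is automatic, because \<open>H\<close> has no loops.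
\<close>

definition joined_parts :: "'b graph \<Rightarrow> nat \<Rightarrow> (nat \<Rightarrow> 'b set) \<Rightarrow> bool" where
  "joined_parts H r S \<longleftrightarrow> (\<forall>i<r. S i \<subseteq> verts H) \<and>
     (\<forall>i<r. \<forall>j<r. i \<noteq> j \<longrightarrow> (\<forall>u\<in>S i. \<forall>v\<in>S j. {u, v} \<in> edges H))"

text \<open>\<open>H\<close> contains the complete \<open>r\<close>-partite graph with \<open>s\<close> vertices in each part.\<close>

definition has_blowup :: "'b graph \<Rightarrow> nat \<Rightarrow> nat \<Rightarrow> bool" where
  "has_blowup H r s \<longleftrightarrow> (\<exists>S. joined_parts H r S \<and> (\<forall>i<r. card (S i) = s))"

text \<open>
  \<open>H\<close> contains a complete \<open>r\<close>-partite graph with at least \<open>t\<close> vertices in each part together with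
  one edge inside a part. Not fixing the part sizes makes it unnecessary to shrink parts.
\<close>

definition has_critical :: "'b graph \<Rightarrow> nat \<Rightarrow> nat \<Rightarrow> bool" where
  "has_critical H r t \<longleftrightarrow> (\<exists>S. joined_parts H r S \<and> (\<forall>i<r. t \<le> card (S i)) \<and>
     (\<exists>i<r. \<exists>x\<in>S i. \<exists>y\<in>S i. {x, y} \<in> edges H))"

lemma joined_partsI:
  assumes "\<And>i. i < r \<Longrightarrow> S i \<subseteq> verts H"
    and "\<And>i j u v. i < r \<Longrightarrow> j < r \<Longrightarrow> i \<noteq> j \<Longrightarrow> u \<in> S i \<Longrightarrow> v \<in> S j \<Longrightarrow> {u, v} \<in> edges H"
  shows "joined_parts H r S"
  using assms unfolding joined_parts_def by blast

lemma joined_partsD: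
  assumes "joined_parts H r S"
  shows "i < r \<Longrightarrow> S i \<subseteq> verts H"
    and "i < r \<Longrightarrow> j < r \<Longrightarrow> i \<noteq> j \<Longrightarrow> u \<in> S i \<Longrightarrow> v \<in> S j \<Longrightarrow> {u, v} \<in> edges H"
  using assms unfolding joined_parts_def by blast+

lemma joined_parts_finite: "simple_graph H \<Longrightarrow> joined_parts H r S \<Longrightarrow> i < r \<Longrightarrow> finite (S i)"
  using joined_partsD(1) by (metis finite_subset simple_graph_def)

lemma joined_parts_disjoint:
  assumes "simple_graph H" "joined_parts H r S" "i < r" "j < r" "i \<noteq> j"
  shows "S i \<inter> S j = {}"
  using edge_in_verts(3)[OF assms(1)] joined_partsD(2)[OF assms(2-5)] by blast

lemma card_Union_parts:
  assumes H: "simple_graph H" and S: "joined_parts H r S"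
    and B: "\<And>i. i < r \<Longrightarrow> B i \<subseteq> S i"
  shows "card (\<Union>i<r. B i) = (\<Sum>i<r. card (B i))"
proof (rule card_UN_disjoint)
  show "\<forall>i\<in>{..<r}. finite (B i)"
    using joined_parts_finite[OF H S] B by (meson finite_subset lessThan_iff)
  show "\<forall>i\<in>{..<r}. \<forall>j\<in>{..<r}. i \<noteq> j \<longrightarrow> B i \<inter> B j = {}"
    using joined_parts_disjoint[OF H S] B by (meson disjoint_iff lessThan_iff subsetD)
qed simp

lemma card_neighbours_parts:
  assumes H: "simple_graph H" and S: "joined_parts H r S"
  shows "card {u \<in> (\<Union>i<r. S i). {u, v} \<in> edges H} = (\<Sum>i<r. card {u \<in> S i. {u, v} \<in> edges H})"
proof -
  have "{u \<in> (\<Union>i<r. S i). {u, v} \<in> edges H} = (\<Union>i<r. {u \<in> S i. {u, v} \<in> edges H})" by auto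
  then show ?thesis using card_Union_parts[OF H S, of "\<lambda>i. {u \<in> S i. {u, v} \<in> edges H}"] by auto
qed

text \<open>The effect on the number of edges of removing a blow-up.\<close>

lemma edges_split_parts:
  fixes S :: "nat \<Rightarrow> 'b set"
  assumes H: "simple_graph H" and S: "joined_parts H r S" and c: "\<And>i. i < r \<Longrightarrow> card (S i) = s"
  defines "U \<equiv> \<Union>i<r. S i"
  shows "U \<subseteq> verts H" "card U = r * s" "card (verts H - U) = card (verts H) - r * s"
    "r * s \<le> card (verts H)"
    "card (edges H) = card (edges (induced H (verts H - U))) + card (edges (induced H U))
      + (\<Sum>v\<in>verts H - U. \<Sum>i<r. card {u \<in> S i. {u, v} \<in> edges H})"
proof -
  have fin: "finite (verts H)" using H by (simp add: simple_graph_def)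
  show sub: "U \<subseteq> verts H" using joined_partsD(1)[OF S] by (auto simp: U_def)
  have "card U = (\<Sum>i<r. card (S i))"
    unfolding U_def by (rule card_Union_parts[OF H S]) simp
  then show U: "card U = r * s" using c by simp
  show "card (verts H - U) = card (verts H) - r * s"
    using card_Diff_subset[OF _ sub] U finite_subset[OF sub fin] by simp
  show "r * s \<le> card (verts H)" using card_mono[OF fin sub] U by simp
  have "card (edges H) = card {e \<in> edges H. e \<subseteq> verts H - U} + card {e \<in> edges H. e \<subseteq> U}
    + (\<Sum>v\<in>verts H - U. card {u \<in> U. {u, v} \<in> edges H})"
    by (rule edges_split[OF H]) (use sub in auto)
  then show "card (edges H) = card (edges (induced H (verts H - U))) + card (edges (induced H U))
      + (\<Sum>v\<in>verts H - U. \<Sum>i<r. card {u \<in> S i. {u, v} \<in> edges H})"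
    using card_neighbours_parts[OF H S] by (simp add: U_def)
qed

lemma joined_parts_mono: "joined_parts H' r S \<Longrightarrow> subgraph H' H \<Longrightarrow> joined_parts H r S"
  unfolding joined_parts_def subgraph_def by blast

lemma has_blowup_mono: "has_blowup H' r s \<Longrightarrow> subgraph H' H \<Longrightarrow> has_blowup H r s"
  unfolding has_blowup_def using joined_parts_mono by blast

lemma has_criticalI:
  "joined_parts H r S \<Longrightarrow> (\<And>i. i < r \<Longrightarrow> t \<le> card (S i)) \<Longrightarrow> i < r \<Longrightarrow> x \<in> S i \<Longrightarrow> y \<in> S i \<Longrightarrow>
    {x, y} \<in> edges H \<Longrightarrow> has_critical H r t"
  unfolding has_critical_def by blast

lemma has_critical_mono:
  assumes "has_critical H' r t" and sub: "subgraph H' H"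
  shows "has_critical H r t"
proof -
  obtain S i x y where "joined_parts H' r S" "\<And>i. i < r \<Longrightarrow> t \<le> card (S i)"
    "i < r" "x \<in> S i" "y \<in> S i" "{x, y} \<in> edges H'"
    using assms(1) unfolding has_critical_def by blast
  moreover from this have "{x, y} \<in> edges H" using sub by (auto simp: subgraph_def)
  ultimately show ?thesis using joined_parts_mono[OF _ sub] has_criticalI by metis
qed

lemma has_blowupI:
  assumes S: "joined_parts H r S" and c: "\<And>i. i < r \<Longrightarrow> s \<le> card (S i)"
  shows "has_blowup H r s"
proof -
  have "\<forall>i. \<exists>T. i < r \<longrightarrow> T \<subseteq> S i \<and> card T = s"
    using c by (meson obtain_subset_with_card_n)
  then obtain T where T: "\<And>i. i < r \<Longrightarrow> T i \<subseteq> S i \<and> card (T i) = s" by metis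
  have "joined_parts H r T"
    using T joined_partsD[OF S] by (intro joined_partsI) blast+
  with T show ?thesis by (auto simp: has_blowup_def)
qed

section \<open>The density bound of Erdos and Stone\<close>

text \<open>
  A blow-up \<open>S\<close> of the complete graph on \<open>r\<close> vertices cannot be joined well to many vertices:
  vertices with the same neighbourhood in \<open>S\<close> serve as a further part.
\<close>

lemma card_well_joined_le:
  fixes S :: "nat \<Rightarrow> 'b set"
  assumes H: "simple_graph H" and S: "joined_parts H r S" and cS: "\<And>i. i < r \<Longrightarrow> card (S i) = s'"
    and free: "\<not> has_blowup H (Suc r) s"
  shows "card {v \<in> verts H. \<forall>i<r. s \<le> card {u \<in> S i. {u, v} \<in> edges H}} \<le> s * 2 ^ (r * s')"
proof -
  let ?U = "\<Union>i<r. S i"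
  let ?W = "{v \<in> verts H. \<forall>i<r. s \<le> card {u \<in> S i. {u, v} \<in> edges H}}"
  let ?N = "\<lambda>v. {u \<in> ?U. {u, v} \<in> edges H}"
  have finW: "finite ?W" and finU: "finite ?U"
    using H edges_split_parts(1)[OF H S cS] by (auto simp: simple_graph_def intro: finite_subset)
  have fibre: "card {v \<in> ?W. ?N v = A} \<le> s" for A
  proof (rule ccontr)
    assume large: "\<not> ?thesis"
    then have big: "s \<le> card {v \<in> ?W. ?N v = A}" by simp
    have "0 < card {v \<in> ?W. ?N v = A}" using large by linarith
    then have "{v \<in> ?W. ?N v = A} \<noteq> {}" unfolding card_gt_0_iff by (rule conjunct1)
    then obtain w where w: "w \<in> ?W" "?N w = A" by blast
    define T where "T i = (if i < r then A \<inter> S i else {v \<in> ?W. ?N v = A})" for i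
    have "joined_parts H (Suc r) T"
    proof (rule joined_partsI)
      fix i assume "i < Suc r"
      then show "T i \<subseteq> verts H" using joined_partsD(1)[OF S, of i] by (auto simp: T_def)
    next
      fix i j u v assume ij: "i < Suc r" "j < Suc r" "i \<noteq> j" and uv: "u \<in> T i" "v \<in> T j"
      have cross: "{a, b} \<in> edges H" if "a \<in> A" "?N b = A" for a b
        using that by blast
      consider "i < r" "j < r" | "i < r" "\<not> j < r" | "\<not> i < r" "j < r"
        using ij by linarith
      then show "{u, v} \<in> edges H"
      proof cases
        case 1
        then show ?thesis using uv ij joined_partsD(2)[OF S] by (auto simp: T_def)
      next
        case 2
        then show ?thesis using uv cross[of u v] by (simp add: T_def)
      next
        case 3
        then have "{v, u} \<in> edges H" using uv cross[of v u] by (simp add: T_def)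
        then show ?thesis by (simp only: insert_commute)
      qed
    qed
    moreover have "s \<le> card (T i)" if "i < Suc r" for i
    proof (cases "i < r")
      case True
      then have "{u \<in> S i. {u, w} \<in> edges H} = A \<inter> S i" using w(2) by blast
      then show ?thesis using w(1) True by (auto simp: T_def)
    next
      case False
      then show ?thesis using big by (simp add: T_def)
    qed
    ultimately show False using free has_blowupI by metis
  qed
  have "?W = (\<Union>A\<in>Pow ?U. {v \<in> ?W. ?N v = A})" by blast
  then have "card ?W = card (\<Union>A\<in>Pow ?U. {v \<in> ?W. ?N v = A})" by (rule arg_cong)
  also have "\<dots> \<le> (\<Sum>A\<in>Pow ?U. card {v \<in> ?W. ?N v = A})"
    by (rule card_UN_le) (use finU in blast)
  also have "\<dots> \<le> (\<Sum>A\<in>Pow ?U. s)" by (intro sum_mono fibre)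
  also have "\<dots> = s * 2 ^ (r * s')"
    using finU edges_split_parts(2)[OF H S cS] by (simp add: card_Pow)
  finally show ?thesis .
qed

text \<open>
  Removing a blow-up with parts of size \<open>s'\<close> removes at most \<open>(r - 1) s' + s\<close> edges per remaining
  vertex, apart from a bounded number of exceptions. As \<open>s\<close> is small compared with \<open>s'\<close>, iterating
  this gives the density \<open>1 - 1 / r\<close>; graphs in which no blow-up can be found are sparse
  enough already. The linear term in the density hypothesis leaves room for the lower bound
  for \<open>turan r n\<close>, which has the same form.
\<close>

lemma edges_bound_if_dense_blowup:
  fixes r s s' n0 :: nat and \<epsilon> :: real
  assumes r: "1 \<le> r" and s: "1 \<le> s" and \<epsilon>: "0 < \<epsilon>" and s': "real s \<le> \<epsilon> * real s'"
    and dense: "\<And>H :: 'b graph. simple_graph H \<Longrightarrow> n0 \<le> card (verts H) \<Longrightarrow>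
      (1 - 1 / real r) * (real (card (verts H)))\<^sup>2 / 2 - real r * real (card (verts H))
        \<le> real (card (edges H)) \<Longrightarrow> has_blowup H r s'"
  shows "\<exists>K. \<forall>H :: 'b graph. simple_graph H \<and> \<not> has_blowup H (Suc r) s \<longrightarrow>
    real (card (edges H)) \<le> (1 - 1 / real r + \<epsilon>) * (real (card (verts H)))\<^sup>2 / 2
      + K * real (card (verts H))"
proof -
  define m where "m = r * s'"
  define C where "C = s * 2 ^ m * m + m * m"
  \<comment> \<open>\<open>C\<close> bounds the edges inside the blow-up and those at the exceptional vertices. The constant
    \<open>K\<close> pays for \<open>C\<close> at every removal, and for all edges once fewer than \<open>n0\<close> vertices remain.\<close>
  define K where "K = real n0 + real C"
  define a where "a = 1 - 1 / real r + \<epsilon>"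
  have a0: "0 \<le> a" using r \<epsilon> by (simp add: a_def)
  have "s' \<noteq> 0" using s s' by (intro notI) simp
  then have m1: "1 \<le> m" using r by (simp add: m_def)
  have "real (card (edges H)) \<le> a * (real (card (verts H)))\<^sup>2 / 2 + K * real (card (verts H))"
    if "simple_graph H" "\<not> has_blowup H (Suc r) s" for H :: "'b graph"
    using that
  proof (induction "card (verts H)" arbitrary: H rule: less_induct)
    case less
    let ?n = "card (verts H)"
    have H: "simple_graph H" using less.prems by simp
    have fin: "finite (verts H)" using H by (simp add: simple_graph_def)
    consider "?n < n0" | "real (card (edges H)) < (1 - 1 / real r) * (real ?n)\<^sup>2 / 2 - real r * real ?n"
      | "has_blowup H r s'"
      using dense[OF H] by linarith
    then show ?case
    proof cases
      case 1
      have "card (edges H) \<le> ?n * ?n" by (rule card_edges_le_square[OF H])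
      also have "\<dots> \<le> n0 * ?n" using 1 by simp
      finally have "real (card (edges H)) \<le> real (n0 * ?n)" by (simp only: of_nat_le_iff)
      also have "\<dots> \<le> K * real ?n" by (simp add: K_def distrib_right)
      finally show ?thesis using a0 by (simp add: add_increasing)
    next
      case 2
      have "0 \<le> \<epsilon> * (real ?n)\<^sup>2 / 2" "0 \<le> K * real ?n" "0 \<le> real r * real ?n"
        using \<epsilon> by (auto simp: K_def)
      with 2 show ?thesis unfolding a_def distrib_right add_divide_distrib by linarith
    next
      case 3
      then obtain S where S: "joined_parts H r S" and cS: "\<And>i. i < r \<Longrightarrow> card (S i) = s'"
        by (auto simp: has_blowup_def)
      define U where "U = (\<Union>i<r. S i)"
      define R where "R = verts H - U"
      define W where "W = {v \<in> verts H. \<forall>i<r. s \<le> card {u \<in> S i. {u, v} \<in> edges H}}"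
      define d where "d v = (\<Sum>i<r. card {u \<in> S i. {u, v} \<in> edges H})" for v
      note split = edges_split_parts[OF H S cS, folded U_def, folded R_def m_def d_def]
      have finR: "finite R" using fin by (simp add: R_def)
      have part: "card {u \<in> S i. {u, v} \<in> edges H} \<le> s'" if "i < r" for i v
        using cS[OF that] joined_parts_finite[OF H S that] by (metis (no_types, lifting) card_mono mem_Collect_eq subsetI)
      have dm: "d v \<le> m" for v
        using sum_bounded_above[of "{..<r}" "\<lambda>i. card {u \<in> S i. {u, v} \<in> edges H}" s'] part
        by (simp add: d_def m_def)
      have d: "d v \<le> (r - 1) * s' + s" if v: "v \<in> R - W" for v
      proof -
        obtain i where i: "i < r" "card {u \<in> S i. {u, v} \<in> edges H} < s"
          using v by (auto simp: W_def R_def not_le)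
        have "d v = card {u \<in> S i. {u, v} \<in> edges H}
            + (\<Sum>j\<in>{..<r} - {i}. card {u \<in> S j. {u, v} \<in> edges H})"
          unfolding d_def using i by (intro sum.remove) auto
        also have "(\<Sum>j\<in>{..<r} - {i}. card {u \<in> S j. {u, v} \<in> edges H}) \<le> (r - 1) * s'"
          using sum_bounded_above[of "{..<r} - {i}" "\<lambda>j. card {u \<in> S j. {u, v} \<in> edges H}" s'] part i
          by simp
        finally show ?thesis using i by simp
      qed
      have "(\<Sum>v\<in>R. d v) = (\<Sum>v\<in>R \<inter> W. d v) + (\<Sum>v\<in>R - W. d v)"
        using finR by (rule sum.Int_Diff)
      also have "(\<Sum>v\<in>R \<inter> W. d v) \<le> card (R \<inter> W) * m"
        using sum_bounded_above[of "R \<inter> W" d m] dm by simp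
      also have "\<dots> \<le> s * 2 ^ m * m"
      proof (rule mult_right_mono)
        have "card (R \<inter> W) \<le> card W" using fin by (intro card_mono) (auto simp: W_def)
        also have "\<dots> \<le> s * 2 ^ m"
          unfolding W_def m_def using card_well_joined_le[OF H S cS less.prems(2)] .
        finally show "card (R \<inter> W) \<le> s * 2 ^ m" .
      qed simp
      also have "(\<Sum>v\<in>R - W. d v) \<le> card (R - W) * ((r - 1) * s' + s)"
        using sum_bounded_above[of "R - W" d "(r - 1) * s' + s"] d by simp
      also have "\<dots> \<le> card R * ((r - 1) * s' + s)"
        by (intro mult_right_mono card_mono finR) auto
      finally have sumd: "(\<Sum>v\<in>R. d v) \<le> s * 2 ^ m * m + card R * ((r - 1) * s' + s)" by simp
      have inU: "card (edges (induced H U)) \<le> m * m"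
        using card_edges_le_square[OF simple_induced[OF H split(1)]] split(2) by simp
      let ?I = "induced H R"
      have R: "R \<subseteq> verts H" by (simp add: R_def)
      have "card (verts ?I) < ?n" using split(3,4) m1 by simp
      moreover have "\<not> has_blowup ?I (Suc r) s"
        using has_blowup_mono[OF _ subgraph_induced[OF H R]] less.prems(2) by blast
      ultimately have IH: "real (card (edges ?I)) \<le> a * (real (card R))\<^sup>2 / 2 + K * real (card R)"
        using less.hyps[of ?I] simple_induced[OF H R] by simp
      have "card (edges H) \<le> card (edges ?I) + (C + card R * ((r - 1) * s' + s))"
        using split(5) inU sumd unfolding C_def by linarith
      then have "real (card (edges H)) \<le> real (card (edges ?I) + (C + card R * ((r - 1) * s' + s)))"
        by (simp only: of_nat_le_iff)
      then have e: "real (card (edges H)) \<le> real (card (edges ?I)) + real C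
          + real (card R) * ((real r - 1) * real s' + real s)"
        using r by (simp add: of_nat_diff)
      have am: "(real r - 1) * real s' + real s \<le> a * real m"
      proof -
        have "1 * (\<epsilon> * real s') \<le> real r * (\<epsilon> * real s')"
          using r \<epsilon> by (intro mult_right_mono) auto
        moreover have "a * real m = (real r - 1) * real s' + real r * (\<epsilon> * real s')"
          using r by (simp add: a_def m_def field_simps)
        ultimately show ?thesis using s' by linarith
      qed
      have n: "real ?n = real (card R) + real m" using split(3,4) by simp
      have sq: "a * (real (card R))\<^sup>2 / 2 + real (card R) * (a * real m) \<le> a * (real ?n)\<^sup>2 / 2"
        using mult_nonneg_nonneg[OF a0 zero_le_power2[of "real m"]]
        unfolding n power2_sum by (simp add: algebra_simps)
      have "real C \<le> K * real m"
        using mult_mono[of "real C" K 1 "real m"] m1 by (simp add: K_def)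
      then have K: "K * real (card R) + real C \<le> K * real ?n"
        by (simp add: n distrib_left)
      have "real (card R) * ((real r - 1) * real s' + real s) \<le> real (card R) * (a * real m)"
        by (rule mult_left_mono[OF am]) simp
      with e IH sq K show ?thesis by linarith
    qed
  qed
  then show ?thesis unfolding a_def by blast
qed

text \<open>
  As \<open>1 - 1 / r < 1 - 1 / (r + 1)\<close>, the bound for graphs without a blow-up of the complete graph on
  \<open>r + 1\<close> vertices provides such a blow-up in all large graphs of density about \<open>1 - 1 / (r + 1)\<close>.
\<close>

lemma blowup_if_dense:
  fixes r s :: nat and \<epsilon> :: real
  assumes r: "1 \<le> r"
    and bound: "\<And>\<epsilon> :: real. 0 < \<epsilon> \<Longrightarrow> \<exists>K. \<forall>H :: 'b graph. simple_graph H \<and> \<not> has_blowup H (Suc r) s \<longrightarrow>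
      real (card (edges H)) \<le> (1 - 1 / real r + \<epsilon>) * (real (card (verts H)))\<^sup>2 / 2
        + K * real (card (verts H))"
  shows "\<exists>n0. \<forall>H :: 'b graph. simple_graph H \<and> n0 \<le> card (verts H) \<and>
    (1 - 1 / real (Suc r)) * (real (card (verts H)))\<^sup>2 / 2 - real (Suc r) * real (card (verts H))
      \<le> real (card (edges H)) \<longrightarrow> has_blowup H (Suc r) s"
proof -
  \<comment> \<open>Half of the gap between the two densities.\<close>
  define \<epsilon> where "\<epsilon> = (1 / real r - 1 / real (Suc r)) / 2"
  have "1 / real (Suc r) < 1 / real r" using r by (intro divide_strict_left_mono) auto
  then have \<epsilon>: "0 < \<epsilon>" by (simp add: \<epsilon>_def)
  from bound[OF this] obtain K where K: "\<And>H :: 'b graph. simple_graph H \<Longrightarrow> \<not> has_blowup H (Suc r) s \<Longrightarrow>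
      real (card (edges H)) \<le> (1 - 1 / real r + \<epsilon>) * (real (card (verts H)))\<^sup>2 / 2
        + K * real (card (verts H))" by blast
  obtain n0 :: nat where n0: "2 * (\<bar>K\<bar> + real (Suc r)) / \<epsilon> < real n0"
    using reals_Archimedean2 by blast
  have "has_blowup H (Suc r) s" if H: "simple_graph H" "n0 \<le> card (verts H)"
    and dense: "(1 - 1 / real (Suc r)) * (real (card (verts H)))\<^sup>2 / 2 - real (Suc r) * real (card (verts H))
      \<le> real (card (edges H))" for H :: "'b graph"
  proof (rule ccontr)
    assume free: "\<not> ?thesis"
    let ?n = "real (card (verts H))"
    have "2 * (\<bar>K\<bar> + real (Suc r)) / \<epsilon> < ?n" using n0 H(2) by linarith
    then have big: "2 * (\<bar>K\<bar> + real (Suc r)) < \<epsilon> * ?n"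
      using \<epsilon> by (simp add: pos_divide_less_eq mult.commute)
    have "0 < ?n" using big \<epsilon> by (cases "card (verts H) = 0") auto
    then have "2 * (\<bar>K\<bar> + real (Suc r)) * ?n < \<epsilon> * ?n * ?n" using big by simp
    then have *: "(\<bar>K\<bar> + real (Suc r)) * ?n < \<epsilon> * ?n\<^sup>2 / 2" by (simp add: power2_eq_square algebra_simps)
    have "(1 - 1 / real (Suc r)) * ?n\<^sup>2 / 2 - real (Suc r) * ?n
        \<le> (1 - 1 / real r + \<epsilon>) * ?n\<^sup>2 / 2 + K * ?n"
      using dense K[OF H(1) free] by linarith
    moreover have "(1 - 1 / real (Suc r)) * ?n\<^sup>2 / 2 = (1 - 1 / real r + 2 * \<epsilon>) * ?n\<^sup>2 / 2"
    proof -
      have "1 - y = 1 - x + 2 * ((x - y) / 2)" for x y :: real by (simp add: field_simps)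
      then have "1 - 1 / real (Suc r) = 1 - 1 / real r + 2 * \<epsilon>" unfolding \<epsilon>_def by blast
      then show ?thesis by (simp only:)
    qed
    moreover have "K * ?n \<le> \<bar>K\<bar> * ?n" by (intro mult_right_mono) auto
    ultimately show False using * unfolding distrib_right add_divide_distrib by linarith
  qed
  then show ?thesis by blast
qed

lemma erdos_stone:
  fixes r s :: nat and \<epsilon> :: real
  assumes "1 \<le> r" "0 < \<epsilon>"
  shows "\<exists>K. \<forall>H :: 'b graph. simple_graph H \<and> \<not> has_blowup H (Suc r) s \<longrightarrow>
    real (card (edges H)) \<le> (1 - 1 / real r + \<epsilon>) * (real (card (verts H)))\<^sup>2 / 2
      + K * real (card (verts H))"
  using assms
proof (induction r arbitrary: s \<epsilon> rule: nat_induct_at_least)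
  case base
  show ?case
  proof (cases "s = 0")
    case True
    have "has_blowup H (Suc 1) 0" for H :: "'b graph"
      by (rule has_blowupI[of _ _ "\<lambda>_. {}"]) (auto intro: joined_partsI)
    with True show ?thesis by simp
  next
    case False
    obtain s' :: nat where "real s / \<epsilon> < real s'" using reals_Archimedean2 by blast
    then have s': "real s \<le> \<epsilon> * real s'" using base by (simp add: pos_divide_less_eq mult.commute)
    show ?thesis
    proof (rule edges_bound_if_dense_blowup[OF _ _ _ s'])
      fix H :: "'b graph" assume "s' \<le> card (verts H)"
      then show "has_blowup H 1 s'"
        by (intro has_blowupI[of _ _ "\<lambda>_. verts H"] joined_partsI) auto
    qed (use False base in auto)
  qed
next
  case (Suc r)
  show ?case
  proof (cases "s = 0")
    case True
    have "has_blowup H (Suc (Suc r)) 0" for H :: "'b graph"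
      by (rule has_blowupI[of _ _ "\<lambda>_. {}"]) (auto intro: joined_partsI)
    with True show ?thesis by simp
  next
    case False
    obtain s' :: nat where "real s / \<epsilon> < real s'" using reals_Archimedean2 by blast
    then have s': "real s \<le> \<epsilon> * real s'" using Suc.prems by (simp add: pos_divide_less_eq mult.commute)
    obtain n0 where "\<forall>H :: 'b graph. simple_graph H \<and> n0 \<le> card (verts H) \<and>
      (1 - 1 / real (Suc r)) * (real (card (verts H)))\<^sup>2 / 2 - real (Suc r) * real (card (verts H))
        \<le> real (card (edges H)) \<longrightarrow> has_blowup H (Suc r) s'"
      using blowup_if_dense[OF Suc.hyps Suc.IH] by blast
    then show ?thesis
      using False Suc.prems by (intro edges_bound_if_dense_blowup[OF _ _ _ s', where ?n0.0 = n0]) auto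
  qed
qed

text \<open>
  A large graph with at least as many edges as an extremal \<open>r\<close>-colourable graph contains
  a complete \<open>r\<close>-partite graph with large parts.
\<close>

lemma blowup_if_turan_le:
  fixes r s :: nat
  assumes "1 \<le> r"
  shows "\<exists>n0. \<forall>H :: 'b graph. simple_graph H \<and> n0 \<le> card (verts H) \<and>
    turan r (card (verts H)) \<le> card (edges H) \<longrightarrow> has_blowup H r s"
proof (cases "r = 1")
  case True
  have "has_blowup H 1 s" if "s \<le> card (verts H)" for H :: "'b graph"
    using that by (intro has_blowupI[of _ _ "\<lambda>_. verts H"] joined_partsI) auto
  with True show ?thesis by blast
next
  case False
  with assms obtain q where q: "r = Suc q" "1 \<le> q" by (cases r) auto
  obtain n0 where n0: "\<forall>H :: 'b graph. simple_graph H \<and> n0 \<le> card (verts H) \<and>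
      (1 - 1 / real r) * (real (card (verts H)))\<^sup>2 / 2 - real r * real (card (verts H))
        \<le> real (card (edges H)) \<longrightarrow> has_blowup H r s"
    using blowup_if_dense[OF q(2) erdos_stone[OF q(2)]] q(1) by blast
  have "has_blowup H r s" if "simple_graph H" "n0 \<le> card (verts H)"
    "turan r (card (verts H)) \<le> card (edges H)" for H :: "'b graph"
  proof -
    have "real (turan r (card (verts H))) \<le> real (card (edges H))" using that by simp
    with turan_lower_bound[OF assms, of "card (verts H)"] n0 that(1,2) show ?thesis
      using order_trans by blast
  qed
  then show ?thesis by blast
qed

section \<open>Graphs without a blow-up plus an edge\<close>

text \<open>
  The vertex \<open>v\<close> can be added to the part \<open>S i\<close>: it has no neighbour in that part and is joined
  to all vertices of the other parts.
\<close>

definition fits_part :: "'b graph \<Rightarrow> nat \<Rightarrow> (nat \<Rightarrow> 'b set) \<Rightarrow> 'b \<Rightarrow> nat \<Rightarrow> bool" where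
  "fits_part H r S v i \<longleftrightarrow> i < r \<and> (\<forall>u\<in>S i. {u, v} \<notin> edges H) \<and>
     (\<forall>j<r. j \<noteq> i \<longrightarrow> (\<forall>u\<in>S j. {u, v} \<in> edges H))"

lemma joined_parts_insert:
  assumes S: "joined_parts H r S" and i: "i < r" and v: "v \<in> verts H"
    and T: "\<And>j. j < r \<Longrightarrow> j \<noteq> i \<Longrightarrow> T j \<subseteq> {u \<in> S j. {u, v} \<in> edges H}" and Ti: "T i = insert v (S i)"
  shows "joined_parts H r T"
proof (rule joined_partsI)
  fix j assume j: "j < r"
  show "T j \<subseteq> verts H"
  proof (cases "j = i")
    case True
    then show ?thesis using joined_partsD(1)[OF S i] Ti v by simp
  next
    case False
    then show ?thesis using joined_partsD(1)[OF S j] T[OF j] by blast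
  qed
next
  fix j k u w assume jk: "j < r" "k < r" "j \<noteq> k" "u \<in> T j" "w \<in> T k"
  have cross: "{b, a} \<in> edges H" if "a \<in> T i" "b \<in> T j" "j < r" "j \<noteq> i" for a b j
  proof (cases "a = v")
    case True
    then show ?thesis using that T[of j] by blast
  next
    case False
    then have "a \<in> S i" "b \<in> S j" using that T[of j] Ti by auto
    then show ?thesis using that joined_partsD(2)[OF S \<open>j < r\<close> i] by blast
  qed
  consider "j = i" | "k = i" | "j \<noteq> i" "k \<noteq> i" by blast
  then show "{u, w} \<in> edges H"
  proof cases
    case 1
    with jk cross[of u w k] have "{w, u} \<in> edges H" by blast
    then show ?thesis by (simp only: insert_commute)
  next
    case 2
    with jk cross[of w u j] show ?thesis by blast
  next
    case 3
    then have "u \<in> S j" "w \<in> S k" using jk T[of j] T[of k] by auto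
    with jk joined_partsD(2)[OF S, of j k u w] show ?thesis by simp
  qed
qed

text \<open>
  If \<open>v\<close> has a neighbour in \<open>S i\<close> and at least \<open>t\<close> neighbours in every other part, then \<open>v\<close> together
  with \<open>S i\<close> is a part that contains an edge. Otherwise \<open>v\<close> misses a whole part, or it has fewer
  than \<open>t\<close> neighbours in each of two parts and hence few neighbours overall.
\<close>

lemma fits_part_or_degree_less:
  fixes S :: "nat \<Rightarrow> 'b set"
  assumes H: "simple_graph H" and r: "1 \<le> r" and S: "joined_parts H r S"
    and cS: "\<And>i. i < r \<Longrightarrow> card (S i) = s" and s: "2 * t \<le> s" "1 \<le> s"
    and free: "\<not> has_critical H r t" and v: "v \<in> verts H"
  shows "(\<exists>i. fits_part H r S v i) \<or> (\<Sum>i<r. card {u \<in> S i. {u, v} \<in> edges H}) < (r - 1) * s"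
proof -
  let ?N = "\<lambda>i. {u \<in> S i. {u, v} \<in> edges H}"
  have finS: "finite (S i)" if "i < r" for i using joined_parts_finite[OF H S that] .
  have part: "card (?N i) \<le> s" if "i < r" for i
    using card_mono[OF finS[OF that], of "?N i"] cS[OF that] by auto
  show ?thesis
  proof (cases "\<exists>i<r. ?N i = {}")
    case True
    then obtain i where i: "i < r" "?N i = {}" by blast
    have sum: "(\<Sum>j<r. card (?N j)) = (\<Sum>j\<in>{..<r} - {i}. card (?N j))"
      using i by (subst sum.remove[of _ i]) (auto simp: i(2))
    show ?thesis
    proof (cases "\<forall>j<r. j \<noteq> i \<longrightarrow> ?N j = S j")
      case True
      then have "fits_part H r S v i" using i unfolding fits_part_def by blast
      then show ?thesis by blast
    next
      case False
      then obtain j where j: "j < r" "j \<noteq> i" "?N j \<noteq> S j" by blast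
      then have "card (?N j) < s" using psubset_card_mono[OF finS[OF j(1)], of "?N j"] cS[OF j(1)] by blast
      then have "(\<Sum>j\<in>{..<r} - {i}. card (?N j)) < (\<Sum>j\<in>{..<r} - {i}. s)"
        using j part by (intro sum_strict_mono_ex1) auto
      then show ?thesis using sum i by simp
    qed
  next
    case False
    have "\<exists>i<r. \<exists>j<r. i \<noteq> j \<and> card (?N i) < t \<and> card (?N j) < t"
    proof (rule ccontr)
      assume none: "\<not> ?thesis"
      obtain i where i: "i < r" "\<And>j. j < r \<Longrightarrow> j \<noteq> i \<Longrightarrow> t \<le> card (?N j)"
      proof (cases "\<exists>i<r. card (?N i) < t")
        case True
        then show ?thesis using none that by (meson not_le)
      next
        case False
        then have "t \<le> card (?N j)" if "j < r" for j using that by (meson not_le_imp_less)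
        then show ?thesis using r by (intro that[of 0]) auto
      qed
      obtain w where w: "w \<in> S i" "{w, v} \<in> edges H" using False i(1) by blast
      define T where "T j = (if j = i then insert v (S i) else ?N j)" for j
      have "joined_parts H r T"
        by (rule joined_parts_insert[OF S i(1) v]) (simp_all add: T_def)
      moreover have "t \<le> card (T j)" if "j < r" for j
      proof (cases "j = i")
        case True
        have "card (S i) \<le> card (insert v (S i))" using finS[OF i(1)] by (intro card_mono) auto
        then show ?thesis using True s cS[OF i(1)] by (simp add: T_def)
      next
        case False
        then show ?thesis using i(2)[OF that] by (simp add: T_def)
      qed
      ultimately have "has_critical H r t"
        by (rule has_criticalI[of H r T t i w v]) (use i w in \<open>auto simp: T_def\<close>)
      with free show False by blast
    qed
    then obtain i j where ij: "i < r" "j < r" "i \<noteq> j" "card (?N i) < t" "card (?N j) < t" by blast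
    have "(\<Sum>k<r. card (?N k)) = card (?N i) + (card (?N j) + (\<Sum>k\<in>{..<r} - {i} - {j}. card (?N k)))"
      using ij by (simp add: sum.remove[of "{..<r}" i] sum.remove[of "{..<r} - {i}" j])
    moreover have "(\<Sum>k\<in>{..<r} - {i} - {j}. card (?N k)) \<le> (r - 2) * s"
      using sum_bounded_above[of "{..<r} - {i} - {j}" "\<lambda>k. card (?N k)" s] part ij
      by (simp add: numeral_2_eq_2)
    moreover have "(r - 1) * s = (r - 2) * s + s"
    proof -
      have "r - 1 = Suc (r - 2)" using ij by linarith
      then show ?thesis by simp
    qed
    ultimately show ?thesis using ij s by linarith
  qed
qed

lemma degree_if_fits_part:
  assumes cS: "\<And>i. i < r \<Longrightarrow> card (S i) = s" and fits: "fits_part H r S v i"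
  shows "(\<Sum>j<r. card {u \<in> S j. {u, v} \<in> edges H}) = (r - 1) * s"
proof -
  have i: "i < r" "{u \<in> S i. {u, v} \<in> edges H} = {}" using fits by (auto simp: fits_part_def)
  have "{u \<in> S j. {u, v} \<in> edges H} = S j" if "j \<in> {..<r} - {i}" for j
    using fits that by (auto simp: fits_part_def)
  then have "(\<Sum>j\<in>{..<r} - {i}. card {u \<in> S j. {u, v} \<in> edges H}) = (\<Sum>j\<in>{..<r} - {i}. s)"
    using cS by (intro sum.cong) auto
  then show ?thesis using i by (subst sum.remove[of _ i]) (auto simp: i(2))
qed

lemma card_edges_le_turan_if_fits_part:
  assumes H: "simple_graph H" and S: "joined_parts H r S"
    and cS: "\<And>i. i < r \<Longrightarrow> t \<le> card (S i)" and free: "\<not> has_critical H r t"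
    and fits: "\<And>v. v \<in> verts H \<Longrightarrow> fits_part H r S v (c v)"
  shows "card (edges H) \<le> turan r (card (verts H))"
proof (rule card_edges_le_turan[OF H, where c = c])
  show "c ` verts H \<subseteq> {..<r}" using fits by (auto simp: fits_part_def)
  fix u v assume uv: "{u, v} \<in> edges H"
  show "c u \<noteq> c v"
  proof
    assume same: "c u = c v"
    note V = edge_in_verts(1,2)[OF H uv]
    define T where "T = S(c v := insert v (S (c v)))"
    define T' where "T' = T(c v := insert u (T (c v)))"
    have i: "c v < r" using fits[OF V(2)] by (simp add: fits_part_def)
    have T: "joined_parts H r T"
      by (rule joined_parts_insert[OF S i V(2)])
        (use fits[OF V(2)] in \<open>auto simp: T_def fits_part_def\<close>)
    have "joined_parts H r T'"
      by (rule joined_parts_insert[OF T i V(1)])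
        (use fits[OF V(1)] same in \<open>auto simp: T'_def T_def fits_part_def\<close>)
    moreover have "t \<le> card (T' j)" if "j < r" for j
    proof -
      have "card (S j) \<le> card (T' j)"
        using joined_parts_finite[OF H S that] by (intro card_mono) (auto simp: T'_def T_def)
      then show ?thesis using cS[OF that] by linarith
    qed
    ultimately have "has_critical H r t"
      by (rule has_criticalI[of H r T' t "c v" u v]) (use i uv in \<open>auto simp: T'_def T_def\<close>)
    with free show False by blast
  qed
qed

text \<open>
  Removing a blow-up of the complete graph on \<open>r\<close> vertices destroys fewer edges than
  \<open>turan_step\<close> gains for the extremal numbers, unless every vertex fits one of the parts. In that case the
  graph is \<open>r\<close>-colourable, which the hypothesis on the number of edges excludes.
\<close>

lemma critical_step:
  fixes S :: "nat \<Rightarrow> 'b set"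
  assumes H: "simple_graph H" and r: "1 \<le> r" and S: "joined_parts H r S"
    and cS: "\<And>i. i < r \<Longrightarrow> card (S i) = s" and s: "2 * t \<le> s" "1 \<le> s"
    and free: "\<not> has_critical H r t" and many: "turan r (card (verts H)) < card (edges H)"
  shows "2 * card (edges H) + 2 \<le> 2 * card (edges (induced H (verts H - (\<Union>i<r. S i))))
    + r * s * ((r - 1) * s) + 2 * ((card (verts H) - r * s) * ((r - 1) * s))"
proof -
  define U where "U = (\<Union>i<r. S i)"
  define R where "R = verts H - U"
  define d where "d v = (\<Sum>i<r. card {u \<in> S i. {u, v} \<in> edges H})" for v
  note split = edges_split_parts[OF H S cS, folded U_def, folded R_def d_def]
  have finR: "finite R" using H by (simp add: R_def simple_graph_def)
  have alt: "(\<exists>i. fits_part H r S v i) \<or> d v < (r - 1) * s" if "v \<in> verts H" for v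
    unfolding d_def by (rule fits_part_or_degree_less[OF H r S cS s free that])
  have dfits: "d v = (r - 1) * s" if "fits_part H r S v i" for v i
    unfolding d_def by (rule degree_if_fits_part[OF cS that])
  have dle: "d v \<le> (r - 1) * s" if "v \<in> verts H" for v
    using alt[OF that] dfits[of v] by fastforce
  have fitsU: "\<exists>i. fits_part H r S v i" if vU: "v \<in> U" for v
  proof -
    obtain i where i: "i < r" "v \<in> S i" using vU by (auto simp: U_def)
    have "{u, v} \<notin> edges H" if "u \<in> S i" for u
      using has_criticalI[OF S _ i(1) that i(2)] cS s free by force
    then have "fits_part H r S v i"
      using i joined_partsD(2)[OF S _ i(1)] by (auto simp: fits_part_def)
    then show ?thesis by blast
  qed
  obtain v where v: "v \<in> R" "\<nexists>i. fits_part H r S v i"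
  proof (rule ccontr)
    assume "\<not> thesis"
    then have "\<forall>v\<in>verts H. \<exists>i. fits_part H r S v i" using fitsU that by (auto simp: R_def)
    then obtain c where "\<And>v. v \<in> verts H \<Longrightarrow> fits_part H r S v (c v)" by metis
    moreover have "t \<le> card (S i)" if "i < r" for i using cS[OF that] s by linarith
    ultimately show False
      using card_edges_le_turan_if_fits_part[OF H S _ free] many by (meson not_le)
  qed
  then have "d v < (r - 1) * s"
    using alt[of v] by (auto simp: R_def)
  then have "(\<Sum>v\<in>R. d v) < (\<Sum>v\<in>R. (r - 1) * s)"
    using finR v dle by (intro sum_strict_mono_ex1) (auto simp: R_def)
  then have out: "(\<Sum>v\<in>R. d v) < (card (verts H) - r * s) * ((r - 1) * s)" using split(3) by simp
  have "2 * card (edges (induced H U)) \<le> card (verts (induced H U)) * ((r - 1) * s)"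
  proof (rule card_edges_le_of_degree[OF simple_induced[OF H split(1)]])
    fix v assume "v \<in> verts (induced H U)"
    then have v: "v \<in> verts H" using split(1) by auto
    have "card {u \<in> verts (induced H U). {u, v} \<in> edges (induced H U)} \<le> card {u \<in> U. {u, v} \<in> edges H}"
      using H split(1) by (intro card_mono) (auto simp: simple_graph_def intro: finite_subset)
    also have "\<dots> = d v" unfolding U_def d_def by (rule card_neighbours_parts[OF H S])
    also have "\<dots> \<le> (r - 1) * s" by (rule dle[OF v])
    finally show "card {u \<in> verts (induced H U). {u, v} \<in> edges (induced H U)} \<le> (r - 1) * s" .
  qed
  then have "2 * card (edges (induced H U)) \<le> r * s * ((r - 1) * s)" using split(2) by simp
  with out split(5) show ?thesis unfolding R_def[symmetric] U_def[symmetric] by linarith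
qed

text \<open>
  The excess of the number of edges over \<^term>\<open>turan r n\<close> drops by at least one whenever a blow-up
  of fixed size is removed, and it is bounded for small graphs. Hence it vanishes for large graphs.
\<close>

lemma card_edges_le_turan_if_not_critical:
  fixes r t :: nat
  assumes r: "1 \<le> r"
  shows "\<exists>n0. \<forall>H :: 'b graph. simple_graph H \<and> n0 \<le> card (verts H) \<and> \<not> has_critical H r t \<longrightarrow>
    card (edges H) \<le> turan r (card (verts H))"
proof -
  \<comment> \<open>Fewer than \<open>t\<close> neighbours in each of two parts are then fewer than \<open>s\<close> in total.\<close>
  define s where "s = 2 * t + 1"
  define m where "m = r * s"
  obtain n0 where n0: "\<And>H :: 'b graph. simple_graph H \<Longrightarrow> n0 \<le> card (verts H) \<Longrightarrow>
      turan r (card (verts H)) \<le> card (edges H) \<Longrightarrow> has_blowup H r s"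
    using blowup_if_turan_le[OF r, of s] by blast
  define M where "M = n0 * n0 + n0"
  have m: "1 \<le> m" using r by (simp add: m_def s_def)
  have bound: "card (edges H) \<le> turan r (card (verts H)) + (M - card (verts H) div m)"
    if "simple_graph H" "\<not> has_critical H r t" for H :: "'b graph"
    using that
  proof (induction "card (verts H)" arbitrary: H rule: less_induct)
    case less
    let ?n = "card (verts H)"
    note H = less.prems(1)
    consider "card (edges H) \<le> turan r ?n" | "?n < n0"
      | "turan r ?n < card (edges H)" "n0 \<le> ?n" by linarith
    then show ?case
    proof cases
      case 1
      then show ?thesis by simp
    next
      case 2
      have "card (edges H) \<le> ?n * ?n" by (rule card_edges_le_square[OF H])
      also have "\<dots> \<le> n0 * n0" using 2 by (intro mult_mono) auto
      finally have "card (edges H) \<le> n0 * n0" .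
      moreover have "?n div m \<le> n0" using 2 div_le_dividend[of ?n m] by linarith
      ultimately show ?thesis unfolding M_def by linarith
    next
      case 3
      then have "has_blowup H r s" using n0[OF H] by simp
      then obtain S where S: "joined_parts H r S" and cS: "\<And>i. i < r \<Longrightarrow> card (S i) = s"
        by (auto simp: has_blowup_def)
      define R where "R = verts H - (\<Union>i<r. S i)"
      note card = edges_split_parts(3,4)[OF H S cS, folded R_def m_def]
      have R: "R \<subseteq> verts H" by (simp add: R_def)
      have IH: "card (edges (induced H R)) \<le> turan r (?n - m) + (M - (?n - m) div m)"
      proof -
        have "card (edges (induced H R))
            \<le> turan r (card (verts (induced H R))) + (M - card (verts (induced H R)) div m)"
        proof (rule less.hyps)
          show "card (verts (induced H R)) < ?n" using card m by simp
          show "\<not> has_critical (induced H R) r t"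
            using has_critical_mono[OF _ subgraph_induced[OF H R]] less.prems(2) by blast
        qed (rule simple_induced[OF H R])
        then show ?thesis using card by simp
      qed
      have "2 * card (edges H) + 2 \<le> 2 * card (edges (induced H R))
          + r * s * ((r - 1) * s) + 2 * ((?n - m) * ((r - 1) * s))"
        unfolding R_def m_def
        by (rule critical_step[OF H r S cS _ _ less.prems(2) 3(1)]) (simp_all add: s_def)
      moreover have "2 * turan r (?n - m) + r * s * ((r - 1) * s) + 2 * ((?n - m) * ((r - 1) * s))
          \<le> 2 * turan r ?n"
        using turan_step[OF r, of "?n - m" s] card(2) by (simp add: m_def)
      moreover have "?n div m = Suc ((?n - m) div m)" using card(2) m by (intro le_div_geq) auto
      ultimately show ?thesis using IH by linarith
    qed
  qed
  have "card (edges H) \<le> turan r (card (verts H))"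
    if "simple_graph H" "M * m \<le> card (verts H)" "\<not> has_critical H r t" for H :: "'b graph"
  proof -
    have "M \<le> card (verts H) div m" using that(2) m by (simp add: less_eq_div_iff_mult_less_eq)
    then show ?thesis using bound[OF that(1,3)] by simp
  qed
  then show ?thesis by blast
qed

section \<open>Embeddings and one-edge extensions\<close>

lemma simple_image:
  assumes G: "simple_graph G" and f: "inj_on f (verts G)"
  shows "simple_graph (f ` verts G, (\<lambda>e. f ` e) ` edges G)"
  unfolding simple_graph_def
proof (intro conjI ballI)
  fix e' assume "e' \<in> edges (f ` verts G, (\<lambda>e. f ` e) ` edges G)"
  then obtain e where e: "e' = f ` e" "e \<in> edges G" by auto
  then have "e \<subseteq> verts G" "card e = 2" using G by (auto simp: simple_graph_def)
  then show "e' \<subseteq> verts (f ` verts G, (\<lambda>e. f ` e) ` edges G)" "card e' = 2"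
    using e(1) card_image[OF inj_on_subset[OF f]] by auto
qed (use G in \<open>simp add: simple_graph_def\<close>)

lemma image_edges_subset:
  assumes G: "simple_graph G"
    and edge: "\<And>u v. {u, v} \<in> edges G \<Longrightarrow> {f u, f v} \<in> E"
  shows "(\<lambda>e. f ` e) ` edges G \<subseteq> E"
proof
  fix e' assume "e' \<in> (\<lambda>e. f ` e) ` edges G"
  then obtain e where e: "e' = f ` e" "e \<in> edges G" by auto
  then obtain u v where "e = {u, v}" using edge_cases[OF G] by metis
  then show "e' \<in> E" using e edge[of u v] by simp
qed

lemma contains_if_embedding:
  assumes G: "simple_graph G" and f: "inj_on f (verts G)" "f ` verts G \<subseteq> verts H"
    and edge: "\<And>u v. {u, v} \<in> edges G \<Longrightarrow> {f u, f v} \<in> edges H"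
  shows "contains H G"
  unfolding contains_def
proof (intro exI conjI)
  let ?G' = "(f ` verts G, (\<lambda>e. f ` e) ` edges G)"
  show "subgraph ?G' H"
    using simple_image[OF G f(1)] f(2) image_edges_subset[OF G edge] by (simp add: subgraph_def)
  show "graph_iso G ?G'"
    using f(1) by (auto simp: graph_iso_def bij_betw_def)
qed

text \<open>The condition on host graphs in the definition of \<^const>\<open>st\<close>.\<close>

definition st_free :: "'b graph \<Rightarrow> 'a graph \<Rightarrow> bool" where
  "st_free H G \<longleftrightarrow> \<not> (\<exists>F. subgraph F H \<and> card (verts F) = card (verts G) \<and> contains_proper F G)"

lemma not_st_free_if_embedding:
  assumes H: "simple_graph H" and G: "simple_graph G"
    and f: "inj_on f (verts G)" "f ` verts G \<subseteq> verts H"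
    and edge: "\<And>u v. {u, v} \<in> edges G \<Longrightarrow> {f u, f v} \<in> edges H"
    and uv: "u \<in> verts G" "v \<in> verts G" "{u, v} \<notin> edges G" "{f u, f v} \<in> edges H"
  shows "\<not> st_free H G"
proof -
  let ?G' = "(f ` verts G, (\<lambda>e. f ` e) ` edges G)"
  let ?F = "(f ` verts G, insert {f u, f v} ((\<lambda>e. f ` e) ` edges G))"
  have G': "simple_graph ?G'" by (rule simple_image[OF G f(1)])
  have sub: "(\<lambda>e. f ` e) ` edges G \<subseteq> edges H" by (rule image_edges_subset[OF G edge])
  have F: "simple_graph ?F"
    using G' uv H unfolding simple_graph_def by auto
  have "{f u, f v} \<notin> (\<lambda>e. f ` e) ` edges G"
  proof
    assume "{f u, f v} \<in> (\<lambda>e. f ` e) ` edges G"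
    then obtain e where e: "e \<in> edges G" "f ` {u, v} = f ` e" by auto
    then have "e \<subseteq> verts G" using G by (auto simp: simple_graph_def)
    with e uv have "e = {u, v}" using inj_on_image_eq_iff[OF f(1), of "{u, v}" e] by auto
    with e uv show False by blast
  qed
  then have "?G' \<noteq> ?F" by auto
  moreover have "subgraph ?G' ?F" using G' by (auto simp: subgraph_def)
  moreover have "graph_iso G ?G'" using f(1) by (auto simp: graph_iso_def bij_betw_def)
  ultimately have proper: "contains_proper ?F G"
    unfolding contains_proper_def by (intro exI[of _ ?G'] conjI)
  have "subgraph ?F H" using F f(2) sub uv(4) by (simp add: subgraph_def)
  moreover have "card (verts ?F) = card (verts G)" using card_image[OF f(1)] by simp
  ultimately show ?thesis unfolding st_free_def using proper by (intro notI) metis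
qed

text \<open>Conversely, a host that is not free contains \<open>G\<close> with one additional edge.\<close>

lemma not_st_freeE:
  assumes H: "simple_graph H" and G: "simple_graph G" and nf: "\<not> st_free H G"
  obtains f u v where "f ` verts G \<subseteq> verts H" "u \<in> verts G" "v \<in> verts G" "u \<noteq> v" "{u, v} \<notin> edges G"
    "\<And>a b. {a, b} \<in> insert {u, v} (edges G) \<Longrightarrow> {f a, f b} \<in> edges H"
proof -
  obtain F G' where F: "subgraph F H" "card (verts F) = card (verts G)"
    and G': "subgraph G' F" "G' \<noteq> F" "graph_iso G G'"
    using nf unfolding st_free_def contains_proper_def by blast
  obtain f where f: "bij_betw f (verts G) (verts G')" "(\<lambda>e. f ` e) ` edges G = edges G'"
    using G'(3) unfolding graph_iso_def by blast
  have sF: "simple_graph F" using F(1) by (simp add: subgraph_def)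
  have "verts G' = verts F"
    using G'(1) F(2) bij_betw_same_card[OF f(1)] sF
    by (intro card_subset_eq) (auto simp: subgraph_def simple_graph_def)
  then have "edges G' \<noteq> edges F" using G'(2) by (auto simp: prod_eq_iff)
  then obtain e where e: "e \<in> edges F" "e \<notin> edges G'" using G'(1) by (auto simp: subgraph_def)
  then obtain x y where xy: "e = {x, y}" "x \<noteq> y" "x \<in> verts F" "y \<in> verts F"
    using edge_cases[OF sF] by metis
  have im: "f ` verts G = verts F" using f(1) \<open>verts G' = verts F\<close> by (simp add: bij_betw_def)
  with xy have "x \<in> f ` verts G" "y \<in> f ` verts G" by auto
  then obtain u v where uv: "u \<in> verts G" "v \<in> verts G" "x = f u" "y = f v" by (elim imageE) simp
  have new: "{u, v} \<notin> edges G"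
  proof
    assume "{u, v} \<in> edges G"
    then have "f ` {u, v} \<in> edges G'" using f(2) by blast
    with e xy uv show False by simp
  qed
  have EH: "edges F \<subseteq> edges H" "edges G' \<subseteq> edges H"
    using F(1) G'(1) by (auto simp: subgraph_def)
  show ?thesis
  proof
    show "f ` verts G \<subseteq> verts H" using im F(1) by (simp add: subgraph_def)
    show "{f a, f b} \<in> edges H" if "{a, b} \<in> insert {u, v} (edges G)" for a b
    proof (cases "{a, b} = {u, v}")
      case True
      then have "f ` {a, b} = f ` {u, v}" by (rule arg_cong)
      then show ?thesis using e xy uv EH by auto
    next
      case False
      then have "f ` {a, b} \<in> edges G'" using that f(2) by blast
      then show ?thesis using EH by auto
    qed
  qed (use uv xy new in auto)
qed

text \<open>The colour classes of \<open>c\<close> are mapped injectively into the corresponding parts.\<close>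

lemma embed_blowup:
  assumes H: "simple_graph H" and S: "joined_parts H r S" and V: "finite V"
    and cS: "\<And>i. i < r \<Longrightarrow> card V \<le> card (S i)" and c: "c ` V \<subseteq> {..<r}"
  obtains f where "inj_on f V" "\<And>v. v \<in> V \<Longrightarrow> f v \<in> S (c v)"
proof -
  have "\<forall>i. \<exists>g. i < r \<longrightarrow> inj_on g V \<and> g ` V \<subseteq> S i"
    using card_le_inj[OF V joined_parts_finite[OF H S]] cS by meson
  then obtain g where g: "\<And>i. i < r \<Longrightarrow> inj_on (g i) V \<and> g i ` V \<subseteq> S i" by metis
  let ?f = "\<lambda>v. g (c v) v"
  have cr: "c v < r" if "v \<in> V" for v using c that by auto
  have mem: "?f v \<in> S (c v)" if "v \<in> V" for v using g[OF cr[OF that]] that by blast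
  have "inj_on ?f V"
  proof (rule inj_onI)
    fix u v assume uv: "u \<in> V" "v \<in> V" "?f u = ?f v"
    have "c u = c v"
    proof (rule ccontr)
      assume "c u \<noteq> c v"
      then have "S (c u) \<inter> S (c v) = {}" using joined_parts_disjoint[OF H S] cr uv by blast
      with mem[OF uv(1)] mem[OF uv(2)] uv(3) show False by auto
    qed
    with uv g[OF cr[OF uv(1)]] show "u = v" by (auto dest: inj_onD)
  qed
  with mem that show thesis by blast
qed

text \<open>
  A graph coloured by \<open>c\<close> with the two vertices \<open>u\<close> and \<open>v\<close> of the same colour embeds so that the
  pair \<open>{u, v}\<close> goes to the additional edge. The colours are permuted to match the part that
  contains this edge.
\<close>

lemma embed_critical:
  assumes H: "simple_graph H" and crit: "has_critical H r t" and V: "finite V" "card V \<le> t"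
    and c: "c ` V \<subseteq> {..<r}" and uv: "u \<in> V" "v \<in> V" "u \<noteq> v" "c u = c v"
  obtains f where "inj_on f V" "f ` V \<subseteq> verts H" "{f u, f v} \<in> edges H"
    "\<And>a b. a \<in> V \<Longrightarrow> b \<in> V \<Longrightarrow> c a \<noteq> c b \<Longrightarrow> {f a, f b} \<in> edges H"
proof -
  obtain S i x y where S: "joined_parts H r S" and cS: "\<And>i. i < r \<Longrightarrow> t \<le> card (S i)"
    and i: "i < r" and xy: "x \<in> S i" "y \<in> S i" "{x, y} \<in> edges H"
    using crit unfolding has_critical_def by blast
  have "x \<noteq> y" using edge_in_verts(3)[OF H xy(3)] .
  \<comment> \<open>The transposition of the colour of \<open>u\<close> and \<open>v\<close> with the index of the part containing the edge.\<close>
  define \<sigma> where "\<sigma> = (\<lambda>k. if k = c u then i else if k = i then c u else k)"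
  have \<sigma>: "\<sigma> k = \<sigma> l \<longleftrightarrow> k = l" for k l by (auto simp: \<sigma>_def)
  have cu: "c u < r" using c uv by auto
  have c': "\<sigma> (c a) < r" if "a \<in> V" for a
  proof -
    have "c a < r" using c that by auto
    then show ?thesis using i cu by (simp add: \<sigma>_def)
  qed
  define S' where "S' = (\<lambda>j. S j - {x, y})"
  let ?V = "V - {u, v}"
  have S': "joined_parts H r S'"
    using joined_partsD[OF S] by (intro joined_partsI) (auto simp: S'_def)
  have cV: "card ?V = card V - 2" using V uv by (simp add: card_Diff_subset)
  have cS': "card (S j) - 2 \<le> card (S' j)" for j
  proof -
    have "card (S j) - card {x, y} \<le> card (S' j)"
      unfolding S'_def by (rule diff_card_le_card_Diff) simp
    then show ?thesis using \<open>x \<noteq> y\<close> by simp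
  qed
  have cVS': "card ?V \<le> card (S' j)" if "j < r" for j
    using cV cS'[of j] cS[OF that] V(2) by linarith
  have "(\<sigma> \<circ> c) ` ?V \<subseteq> {..<r}" using c' by auto
  from embed_blowup[OF H S' finite_Diff[OF V(1)] cVS' this]
  obtain g where g: "inj_on g ?V" "\<And>a. a \<in> ?V \<Longrightarrow> g a \<in> S' (\<sigma> (c a))"
    unfolding comp_apply by blast
  define f where "f = g(u := x, v := y)"
  have f: "f u = x" "f v = y" using uv by (simp_all add: f_def)
  have fg: "f a = g a" if "a \<in> ?V" for a using that by (simp add: f_def)
  have mem: "f a \<in> S (\<sigma> (c a))" if "a \<in> V" for a
  proof (cases "a \<in> ?V")
    case True
    then show ?thesis using fg g(2) by (simp add: S'_def)
  next
    case False
    then have "a = u \<or> a = v" using that by blast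
    moreover have "\<sigma> (c u) = i" by (simp add: \<sigma>_def)
    ultimately show ?thesis using f xy uv(4) by auto
  qed
  have "inj_on f V"
  proof (rule inj_onI)
    fix a b assume ab: "a \<in> V" "b \<in> V" "f a = f b"
    have "f a \<notin> {x, y}" if "a \<in> ?V" for a using g(2)[OF that] fg[OF that] by (simp add: S'_def)
    then have "a \<in> ?V \<longleftrightarrow> b \<in> ?V" using ab f by (metis DiffE DiffI insert_iff singletonD)
    then consider "a \<in> ?V" "b \<in> ?V" | "a \<in> {u, v}" "b \<in> {u, v}" using ab by blast
    then show "a = b"
    proof cases
      case 1
      then show ?thesis using ab fg g(1) by (metis inj_onD)
    next
      case 2
      then show ?thesis using ab f \<open>x \<noteq> y\<close> by auto
    qed
  qed
  moreover have "f ` V \<subseteq> verts H" using mem c' joined_partsD(1)[OF S] by blast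
  moreover have "{f u, f v} \<in> edges H" using f xy by simp
  moreover have "{f a, f b} \<in> edges H" if "a \<in> V" "b \<in> V" "c a \<noteq> c b" for a b
    using joined_partsD(2)[OF S c'[OF that(1)] c'[OF that(2)] _ mem[OF that(1)] mem[OF that(2)]] that(3) \<sigma>
    by simp
  ultimately show thesis using that by blast
qed

section \<open>Chromatic numbers\<close>

lemma colourableI:
  "c ` verts G \<subseteq> {..<r} \<Longrightarrow> (\<And>u v. {u, v} \<in> edges G \<Longrightarrow> u \<noteq> v \<Longrightarrow> c u \<noteq> c v) \<Longrightarrow> colourable r G"
  unfolding colourable_def by blast

lemma colourableE:
  assumes "simple_graph G" "colourable r G"
  obtains c where "c ` verts G \<subseteq> {..<r}" "\<And>u v. {u, v} \<in> edges G \<Longrightarrow> c u \<noteq> c v"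
proof -
  obtain c where c: "c ` verts G \<subseteq> {..<r}" "\<forall>u v. {u, v} \<in> edges G \<and> u \<noteq> v \<longrightarrow> c u \<noteq> c v"
    using assms(2) unfolding colourable_def by blast
  show thesis
  proof (rule that[OF c(1)])
    fix u v assume uv: "{u, v} \<in> edges G"
    then show "c u \<noteq> c v" using c(2) edge_in_verts(3)[OF assms(1) uv] by simp
  qed
qed

lemma colourable_chromatic_number:
  assumes G: "simple_graph G"
  shows "colourable (chromatic_number G) G"
proof -
  obtain h where h: "bij_betw h (verts G) {..<card (verts G)}"
    using G ex_bij_betw_finite_nat[of "verts G"] by (auto simp: simple_graph_def atLeast0LessThan)
  have "colourable (card (verts G)) G"
  proof (rule colourableI[where c = h])
    fix u v assume "{u, v} \<in> edges G" "u \<noteq> v"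
    then show "h u \<noteq> h v" using edge_in_verts[OF G] h by (metis bij_betw_inv_into_left)
  qed (use h in \<open>auto simp: bij_betw_def\<close>)
  then show ?thesis unfolding chromatic_number_def by (rule LeastI)
qed

lemma chromatic_number_le: "colourable r G \<Longrightarrow> chromatic_number G \<le> r"
  unfolding chromatic_number_def by (rule Least_le)

lemma finite_extensions:
  assumes G: "simple_graph G"
  shows "finite (one_edge_extensions G)"
proof (rule finite_subset)
  show "one_edge_extensions G \<subseteq> {verts G} \<times> Pow (Pow (verts G))"
    using G by (auto simp: one_edge_extensions_def simple_graph_def)
qed (use G in \<open>simp add: simple_graph_def\<close>)

lemma simple_extension:
  assumes "simple_graph G" "K \<in> one_edge_extensions G"
  shows "simple_graph K"
proof -
  obtain u v where "K = (verts G, insert {u, v} (edges G))" "{u, v} \<subseteq> verts G" "card {u, v} = 2"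
    using assms(2) by (auto simp: one_edge_extensions_def)
  then show ?thesis using assms(1) unfolding simple_graph_def by simp
qed

lemma extensionI:
  "u \<in> verts G \<Longrightarrow> v \<in> verts G \<Longrightarrow> u \<noteq> v \<Longrightarrow> {u, v} \<notin> edges G \<Longrightarrow>
    (verts G, insert {u, v} (edges G)) \<in> one_edge_extensions G"
  unfolding one_edge_extensions_def by blast

lemma not_colourable_extension:
  assumes G: "simple_graph G" and K: "K \<in> one_edge_extensions G" and r: "r < chromatic_number_D G"
  shows "\<not> colourable r K"
proof
  assume "colourable r K"
  then have "chromatic_number K \<le> r" by (rule chromatic_number_le)
  moreover have "chromatic_number_D G \<le> chromatic_number K"
    unfolding chromatic_number_D_def using finite_extensions[OF G] K by (intro Min_le) auto
  ultimately show False using r by simp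
qed

lemma colourable_extension:
  assumes G: "simple_graph G" "\<not> complete_graph G"
  obtains K where "K \<in> one_edge_extensions G" "colourable (chromatic_number_D G) K"
proof -
  obtain u v where "u \<in> verts G" "v \<in> verts G" "u \<noteq> v" "{u, v} \<notin> edges G"
    using G(2) by (auto simp: complete_graph_def)
  from extensionI[OF this] have "one_edge_extensions G \<noteq> {}" by (rule ex_in_conv[THEN iffD1, OF exI])
  then have "chromatic_number_D G \<in> chromatic_number ` one_edge_extensions G"
    unfolding chromatic_number_D_def using finite_extensions[OF G(1)] by (intro Min_in) auto
  then show thesis
    using that colourable_chromatic_number simple_extension[OF G(1)] by (metis imageE)
qed

section \<open>Bounds for the extremal functions\<close>

lemma finite_edge_counts:
  "finite {card (edges H) | H :: nat graph. simple_graph H \<and> card (verts H) = n \<and> P H}"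
proof (rule finite_subset)
  show "{card (edges H) | H :: nat graph. simple_graph H \<and> card (verts H) = n \<and> P H} \<subseteq> {..n * n}"
    using card_edges_le_square by auto
qed simp

lemma card_edges_le_st:
  fixes H :: "nat graph"
  assumes "simple_graph H" "card (verts H) = n" "st_free H G"
  shows "card (edges H) \<le> st n G"
  unfolding st_def st_free_def[symmetric]
  by (rule Max_ge[OF finite_edge_counts]) (use assms in blast)

lemma card_edges_le_ex:
  fixes H :: "nat graph"
  assumes "simple_graph H" "card (verts H) = n" "\<not> contains H G"
  shows "card (edges H) \<le> ex n G"
  unfolding ex_def by (rule Max_ge[OF finite_edge_counts]) (use assms in blast)

lemma simple_edgeless: "simple_graph ({..<n :: nat}, {})"
  by (simp add: simple_graph_def)

lemma st_attained:
  assumes G: "simple_graph G"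
  obtains H :: "nat graph" where "simple_graph H" "card (verts H) = n" "st_free H G" "card (edges H) = st n G"
proof -
  have "st_free ({..<n}, {}) G"
  proof (rule ccontr)
    assume "\<not> ?thesis"
    from not_st_freeE[OF simple_edgeless G this] show False by (metis insertI1 snd_conv empty_iff)
  qed
  then have "{card (edges H) | H :: nat graph. simple_graph H \<and> card (verts H) = n \<and> st_free H G} \<noteq> {}"
    using simple_edgeless[of n] by force
  from Max_in[OF finite_edge_counts this] show ?thesis
    using that by (auto simp: st_def st_free_def)
qed

lemma ex_attained:
  assumes G: "edges G \<noteq> {}"
  obtains H :: "nat graph" where "simple_graph H" "card (verts H) = n" "\<not> contains H G" "card (edges H) = ex n G"
proof -
  have "\<not> contains ({..<n}, {}) G"
    using G by (auto simp: contains_def subgraph_def graph_iso_def)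
  then have "{card (edges H) | H :: nat graph. simple_graph H \<and> card (verts H) = n \<and> \<not> contains H G} \<noteq> {}"
    using simple_edgeless[of n] by force
  from Max_in[OF finite_edge_counts this] show ?thesis
    using that by (auto simp: ex_def)
qed

lemma turan_le_st:
  assumes G: "simple_graph G" and r: "1 \<le> r" "r < chromatic_number_D G"
  shows "turan r n \<le> st n G"
proof -
  obtain c where c: "c ` {..<n} \<subseteq> {..<r}" "turan r n = card (edges (partite_graph {..<n} c))"
    using turan_attained[OF r(1)] .
  let ?P = "partite_graph {..<n} c"
  have P: "simple_graph ?P" by (simp add: simple_partite_graph)
  have "st_free ?P G"
  proof (rule ccontr)
    assume "\<not> ?thesis"
    then obtain f u v where f: "f ` verts G \<subseteq> verts ?P" and uv: "u \<in> verts G" "v \<in> verts G" "u \<noteq> v" "{u, v} \<notin> edges G"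
      and edge: "\<And>a b. {a, b} \<in> insert {u, v} (edges G) \<Longrightarrow> {f a, f b} \<in> edges ?P"
      using not_st_freeE[OF P G] by metis
    have "colourable r (verts G, insert {u, v} (edges G))"
    proof (rule colourableI[where c = "c \<circ> f"])
      show "(c \<circ> f) ` verts (verts G, insert {u, v} (edges G)) \<subseteq> {..<r}" using f c(1) by auto
      fix a b assume "{a, b} \<in> edges (verts G, insert {u, v} (edges G))"
      then have "{f a, f b} \<in> edges ?P" using edge by simp
      then show "(c \<circ> f) a \<noteq> (c \<circ> f) b" by (simp add: edge_partite_graph_iff)
    qed
    with not_colourable_extension[OF G extensionI[OF uv] r(2)] show False by blast
  qed
  then show ?thesis using card_edges_le_st[OF P, of n G] c(2) by simp
qed

lemma simple_complete_graph_on: "simple_graph (complete_graph_on r)"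
  by (auto simp: simple_graph_def complete_graph_on_def card_insert_if)

lemma edge_complete_graph_on_iff: "{u, v} \<in> edges (complete_graph_on r) \<longleftrightarrow> u < r \<and> v < r \<and> u \<noteq> v"
  by (auto simp: complete_graph_on_def doubleton_eq_iff)

lemma verts_complete_graph_on: "verts (complete_graph_on r) = {..<r}"
  by (simp add: complete_graph_on_def)

lemma turan_le_ex:
  assumes r: "1 \<le> r"
  shows "turan r n \<le> ex n (complete_graph_on (Suc r))"
proof -
  obtain c where c: "c ` {..<n} \<subseteq> {..<r}" "turan r n = card (edges (partite_graph {..<n} c))"
    using turan_attained[OF r] .
  let ?P = "partite_graph {..<n} c" and ?K = "complete_graph_on (Suc r)"
  have P: "simple_graph ?P" by (simp add: simple_partite_graph)
  have "\<not> contains ?P ?K"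
  proof
    assume "contains ?P ?K"
    then obtain G' f where G': "subgraph G' ?P" and f: "bij_betw f {..<Suc r} (verts G')"
      and fe: "(\<lambda>e. f ` e) ` edges ?K = edges G'"
      unfolding contains_def graph_iso_def verts_complete_graph_on by blast
    have "inj_on (c \<circ> f) {..<Suc r}"
    proof (rule inj_onI, rule ccontr)
      fix a b assume ab: "a \<in> {..<Suc r}" "b \<in> {..<Suc r}" "(c \<circ> f) a = (c \<circ> f) b" "a \<noteq> b"
      then have "{a, b} \<in> edges ?K" by (simp add: edge_complete_graph_on_iff)
      then have "f ` {a, b} \<in> edges G'" using fe by blast
      then have "f ` {a, b} \<in> edges ?P" using G' by (auto simp: subgraph_def)
      with ab show False by (simp add: edge_partite_graph_iff)
    qed
    then have "card {..<Suc r} \<le> card {..<r}"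
    proof (rule card_inj_on_le)
      show "(c \<circ> f) ` {..<Suc r} \<subseteq> {..<r}"
        using f G' c(1) by (fastforce simp: bij_betw_def subgraph_def)
    qed simp
    then show False by simp
  qed
  then show ?thesis using card_edges_le_ex[OF P, of n ?K] c(2) by simp
qed

lemma complete_graph_on_edges_nonempty: "2 \<le> r \<Longrightarrow> edges (complete_graph_on r) \<noteq> {}"
  using edge_complete_graph_on_iff[of 0 1 r] by force

lemma contains_complete_if_blowup:
  assumes H: "simple_graph H" and "has_blowup H r r"
  shows "contains H (complete_graph_on r)"
proof -
  obtain S where S: "joined_parts H r S" "\<And>i. i < r \<Longrightarrow> card (S i) = r"
    using assms(2) by (auto simp: has_blowup_def)
  obtain f where f: "inj_on f {..<r}" "\<And>v. v \<in> {..<r} \<Longrightarrow> f v \<in> S (id v)"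
    by (rule embed_blowup[OF H S(1), of "{..<r}" id]) (use S(2) in auto)
  show ?thesis
  proof (rule contains_if_embedding[OF simple_complete_graph_on, where f = f])
    show "f ` verts (complete_graph_on r) \<subseteq> verts H"
      using f joined_partsD(1)[OF S(1)] by (fastforce simp: verts_complete_graph_on)
    fix u v assume "{u, v} \<in> edges (complete_graph_on r)"
    then have "u < r" "v < r" "u \<noteq> v" by (simp_all add: edge_complete_graph_on_iff)
    then show "{f u, f v} \<in> edges H" using joined_partsD(2)[OF S(1), of u v] f(2) by simp
  qed (use f in \<open>simp add: verts_complete_graph_on\<close>)
qed

lemma contains_complete_if_critical:
  assumes H: "simple_graph H" and r: "1 \<le> r" and crit: "has_critical H r (Suc r)"
  shows "contains H (complete_graph_on (Suc r))"
proof -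
  \<comment> \<open>The last vertex gets the colour of the first one; all other colours are distinct.\<close>
  define c where "c = (\<lambda>v. if v = r then 0 else v)"
  obtain f where f: "inj_on f {..<Suc r}" "f ` {..<Suc r} \<subseteq> verts H" "{f 0, f r} \<in> edges H"
    "\<And>a b. a \<in> {..<Suc r} \<Longrightarrow> b \<in> {..<Suc r} \<Longrightarrow> c a \<noteq> c b \<Longrightarrow> {f a, f b} \<in> edges H"
    by (rule embed_critical[OF H crit, of "{..<Suc r}" c 0 r]) (use r in \<open>auto simp: c_def\<close>)
  show ?thesis
  proof (rule contains_if_embedding[OF simple_complete_graph_on, where f = f])
    fix u v assume "{u, v} \<in> edges (complete_graph_on (Suc r))"
    then have uv: "u < Suc r" "v < Suc r" "u \<noteq> v" by (simp_all add: edge_complete_graph_on_iff)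
    show "{f u, f v} \<in> edges H"
    proof (cases "c u = c v")
      case True
      then have "{f u, f v} = {f 0, f r}" using uv by (auto simp: c_def split: if_splits)
      then show ?thesis using f(3) by simp
    next
      case False
      then show ?thesis using f(4) uv by simp
    qed
  qed (use f in \<open>simp_all add: verts_complete_graph_on\<close>)
qed

lemma no_blowup_if_st_free:
  assumes H: "simple_graph H" and G: "simple_graph G"
    and K: "K \<in> one_edge_extensions G" "colourable r K" and free: "st_free H G"
  shows "\<not> has_blowup H r (card (verts G))"
proof
  assume "has_blowup H r (card (verts G))"
  then obtain S where S: "joined_parts H r S" "\<And>i. i < r \<Longrightarrow> card (S i) = card (verts G)"
    by (auto simp: has_blowup_def)
  obtain u v where uv: "u \<in> verts G" "v \<in> verts G" "{u, v} \<notin> edges G" "u \<noteq> v"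
    and K': "K = (verts G, insert {u, v} (edges G))"
    using K(1) by (auto simp: one_edge_extensions_def)
  obtain c where c: "c ` verts K \<subseteq> {..<r}" "\<And>u v. {u, v} \<in> edges K \<Longrightarrow> c u \<noteq> c v"
    using colourableE[OF simple_extension[OF G K(1)] K(2)] by metis
  obtain f where f: "inj_on f (verts G)" "\<And>v. v \<in> verts G \<Longrightarrow> f v \<in> S (c v)"
    by (rule embed_blowup[OF H S(1), of "verts G" c])
      (use S(2) c(1) K' G in \<open>auto simp: simple_graph_def\<close>)
  have cr: "c a < r" if "a \<in> verts G" for a using c(1) K' that by auto
  have edge: "{f a, f b} \<in> edges H" if "{a, b} \<in> edges K" for a b
  proof -
    have ab: "a \<in> verts G" "b \<in> verts G"
      using edge_in_verts[OF simple_extension[OF G K(1)] that] K' by simp_all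
    show ?thesis
      using joined_partsD(2)[OF S(1) cr[OF ab(1)] cr[OF ab(2)] c(2)[OF that] f(2)[OF ab(1)] f(2)[OF ab(2)]] .
  qed
  have "\<not> st_free H G"
  proof (rule not_st_free_if_embedding[OF H G f(1) _ _ uv(1,2,3)])
    show "f ` verts G \<subseteq> verts H" using f(2) cr joined_partsD(1)[OF S(1)] by blast
  qed (use edge K' in auto)
  with free show False by blast
qed

text \<open>A function between \<open>turan r n\<close> and the bound of Erdos and Stone has a determined density.\<close>

lemma tendsto_density:
  fixes f :: "nat \<Rightarrow> nat"
  assumes r: "1 \<le> r" and lower: "\<And>n. turan r n \<le> f n"
    and upper: "\<And>\<epsilon> :: real. 0 < \<epsilon> \<Longrightarrow> \<exists>K. \<forall>n. real (f n) \<le> (1 - 1 / real r + \<epsilon>) * (real n)\<^sup>2 / 2 + K * real n"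
  shows "(\<lambda>n. real (f n) / (real n)\<^sup>2) \<longlonglongrightarrow> (1 - 1 / real r) / 2"
proof (rule order_tendstoI)
  have inv: "(\<lambda>n. C / real n) \<longlonglongrightarrow> 0" for C by (rule lim_const_over_n)
  fix a :: real assume a: "a < (1 - 1 / real r) / 2"
  have "(\<lambda>n. (1 - 1 / real r) / 2 - real r / real n) \<longlonglongrightarrow> (1 - 1 / real r) / 2 - 0"
    by (intro tendsto_intros inv)
  then have "\<forall>\<^sub>F n in sequentially. a < (1 - 1 / real r) / 2 - real r / real n"
    using a by (intro order_tendstoD(1)) auto
  then show "\<forall>\<^sub>F n in sequentially. a < real (f n) / (real n)\<^sup>2"
    using eventually_gt_at_top[of 0]
  proof eventually_elim
    case (elim n)
    have "(1 - 1 / real r) * (real n)\<^sup>2 / 2 - real r * real n \<le> real (f n)"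
      using turan_lower_bound[OF r, of n] lower[of n] by linarith
    then have "((1 - 1 / real r) * (real n)\<^sup>2 / 2 - real r * real n) / (real n)\<^sup>2 \<le> real (f n) / (real n)\<^sup>2"
      by (rule divide_right_mono) simp
    moreover have "((1 - 1 / real r) * (real n)\<^sup>2 / 2 - real r * real n) / (real n)\<^sup>2
        = (1 - 1 / real r) / 2 - real r / real n"
      using elim(2) by (simp add: diff_divide_distrib power2_eq_square)
    ultimately show ?case using elim(1) by linarith
  qed
next
  have inv: "(\<lambda>n. C / real n) \<longlonglongrightarrow> 0" for C by (rule lim_const_over_n)
  fix a :: real assume a: "(1 - 1 / real r) / 2 < a"
  define \<epsilon> where "\<epsilon> = a - (1 - 1 / real r) / 2"
  have \<epsilon>: "0 < \<epsilon>" using a by (simp add: \<epsilon>_def)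
  have lim: "(1 - 1 / real r + \<epsilon>) / 2 < a" using \<epsilon> by (simp add: \<epsilon>_def field_simps)
  obtain K where K: "\<And>n. real (f n) \<le> (1 - 1 / real r + \<epsilon>) * (real n)\<^sup>2 / 2 + K * real n"
    using upper[OF \<epsilon>] by blast
  have "(\<lambda>n. (1 - 1 / real r + \<epsilon>) / 2 + K / real n) \<longlonglongrightarrow> (1 - 1 / real r + \<epsilon>) / 2 + 0"
    by (intro tendsto_intros inv)
  then have "\<forall>\<^sub>F n in sequentially. (1 - 1 / real r + \<epsilon>) / 2 + K / real n < a"
    using lim by (intro order_tendstoD(2)) auto
  then show "\<forall>\<^sub>F n in sequentially. real (f n) / (real n)\<^sup>2 < a"
    using eventually_gt_at_top[of 0]
  proof eventually_elim
    case (elim n)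
    have "real (f n) / (real n)\<^sup>2 \<le> ((1 - 1 / real r + \<epsilon>) * (real n)\<^sup>2 / 2 + K * real n) / (real n)\<^sup>2"
      by (rule divide_right_mono[OF K]) simp
    moreover have "((1 - 1 / real r + \<epsilon>) * (real n)\<^sup>2 / 2 + K * real n) / (real n)\<^sup>2
        = (1 - 1 / real r + \<epsilon>) / 2 + K / real n"
      using elim(2) by (simp add: add_divide_distrib power2_eq_square)
    ultimately show ?case using elim(1) by linarith
  qed
qed

lemma st_density:
  assumes G: "simple_graph G" "\<not> complete_graph G" and r: "1 \<le> r" "chromatic_number_D G = Suc r"
  shows "(\<lambda>n. real (st n G) / (real n)\<^sup>2) \<longlonglongrightarrow> (1 - 1 / real r) / 2"
proof (rule tendsto_density[OF r(1)])
  show "turan r n \<le> st n G" for n using turan_le_st[OF G(1) r(1)] r(2) by simp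
  obtain K where K: "K \<in> one_edge_extensions G" "colourable (Suc r) K"
    using colourable_extension[OF G] r(2) by metis
  fix \<epsilon> :: real assume "0 < \<epsilon>"
  then obtain C where C: "\<And>H :: nat graph. simple_graph H \<Longrightarrow> \<not> has_blowup H (Suc r) (card (verts G)) \<Longrightarrow>
    real (card (edges H)) \<le> (1 - 1 / real r + \<epsilon>) * (real (card (verts H)))\<^sup>2 / 2 + C * real (card (verts H))"
    using erdos_stone[OF r(1)] by blast
  show "\<exists>C. \<forall>n. real (st n G) \<le> (1 - 1 / real r + \<epsilon>) * (real n)\<^sup>2 / 2 + C * real n"
  proof (intro exI allI)
    fix n
    obtain H :: "nat graph" where H: "simple_graph H" "card (verts H) = n" "st_free H G" "card (edges H) = st n G"
      using st_attained[OF G(1)] .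
    then show "real (st n G) \<le> (1 - 1 / real r + \<epsilon>) * (real n)\<^sup>2 / 2 + C * real n"
      using C[OF H(1) no_blowup_if_st_free[OF H(1) G(1) K H(3)]] by simp
  qed
qed

lemma ex_complete_density:
  assumes r: "1 \<le> r"
  shows "(\<lambda>n. real (ex n (complete_graph_on (Suc r))) / (real n)\<^sup>2) \<longlonglongrightarrow> (1 - 1 / real r) / 2"
proof (rule tendsto_density[OF r turan_le_ex[OF r]])
  fix \<epsilon> :: real assume "0 < \<epsilon>"
  then obtain C where C: "\<And>H :: nat graph. simple_graph H \<Longrightarrow> \<not> has_blowup H (Suc r) (Suc r) \<Longrightarrow>
    real (card (edges H)) \<le> (1 - 1 / real r + \<epsilon>) * (real (card (verts H)))\<^sup>2 / 2 + C * real (card (verts H))"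
    using erdos_stone[OF r] by blast
  show "\<exists>C. \<forall>n. real (ex n (complete_graph_on (Suc r)))
      \<le> (1 - 1 / real r + \<epsilon>) * (real n)\<^sup>2 / 2 + C * real n"
  proof (intro exI allI)
    fix n
    obtain H :: "nat graph" where H: "simple_graph H" "card (verts H) = n"
      "\<not> contains H (complete_graph_on (Suc r))" "card (edges H) = ex n (complete_graph_on (Suc r))"
      using ex_attained[OF complete_graph_on_edges_nonempty[of "Suc r"]] r by auto
    have "\<not> has_blowup H (Suc r) (Suc r)" using contains_complete_if_blowup[OF H(1)] H(3) by blast
    then show "real (ex n (complete_graph_on (Suc r)))
        \<le> (1 - 1 / real r + \<epsilon>) * (real n)\<^sup>2 / 2 + C * real n"
      using C[OF H(1)] H by simp
  qed
qed

section \<open>Critical extensions\<close>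

text \<open>
  If every additional edge increases the chromatic number \<open>r\<close>, then in any \<open>r\<close>-colouring
  exactly the pairs of different colours are edges, and no colour is unused.
\<close>

lemma critical_colouring:
  assumes G: "simple_graph G" "\<not> complete_graph G" and D: "chromatic_number_D G = chromatic_number G + 1"
  obtains c where "c ` verts G = {..<chromatic_number G}"
    "\<And>u v. u \<in> verts G \<Longrightarrow> v \<in> verts G \<Longrightarrow> {u, v} \<in> edges G \<longleftrightarrow> c u \<noteq> c v"
proof -
  let ?r = "chromatic_number G"
  obtain c where c: "c ` verts G \<subseteq> {..<?r}" "\<And>u v. {u, v} \<in> edges G \<Longrightarrow> c u \<noteq> c v"
    using colourableE[OF G(1) colourable_chromatic_number[OF G(1)]] by metis
  have no: "\<not> colourable ?r (verts G, insert {u, v} (edges G))"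
    if "u \<in> verts G" "v \<in> verts G" "u \<noteq> v" "{u, v} \<notin> edges G" for u v
    using not_colourable_extension[OF G(1) extensionI[OF that]] D by simp
  have edge: "{u, v} \<in> edges G" if uv: "u \<in> verts G" "v \<in> verts G" "c u \<noteq> c v" for u v
  proof (rule ccontr)
    assume new: "{u, v} \<notin> edges G"
    have "colourable ?r (verts G, insert {u, v} (edges G))"
    proof (rule colourableI[where c = c])
      fix a b assume "{a, b} \<in> edges (verts G, insert {u, v} (edges G))"
      then show "c a \<noteq> c b" using c(2) uv(3) by (auto simp: doubleton_eq_iff)
    qed (use c(1) in simp)
    with no[OF uv(1,2) _ new] uv(3) show False by blast
  qed
  have "j \<in> c ` verts G" if j: "j < ?r" for j
  proof (rule ccontr)
    assume unused: "j \<notin> c ` verts G"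
    obtain u v where uv: "u \<in> verts G" "v \<in> verts G" "u \<noteq> v" "{u, v} \<notin> edges G"
      using G(2) by (auto simp: complete_graph_def)
    \<comment> \<open>The unused colour would serve for one end of the additional edge.\<close>
    have "colourable ?r (verts G, insert {u, v} (edges G))"
    proof (rule colourableI[where c = "c(u := j)"])
      show "(c(u := j)) ` verts (verts G, insert {u, v} (edges G)) \<subseteq> {..<?r}" using c(1) j by auto
      fix a b assume ab: "{a, b} \<in> edges (verts G, insert {u, v} (edges G))" "a \<noteq> b"
      then have V: "a \<in> verts G" "b \<in> verts G"
        using edge_in_verts[OF G(1), of a b] uv by (auto simp: doubleton_eq_iff)
      then have "c a \<noteq> j" "c b \<noteq> j" using unused by auto
      then show "(c(u := j)) a \<noteq> (c(u := j)) b" using ab c(2) uv(3) by (auto simp: doubleton_eq_iff)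
    qed
    with no[OF uv] show False by blast
  qed
  then have "c ` verts G = {..<?r}" using c(1) by blast
  with c(2) edge that show thesis by blast
qed

lemma complete_partite_if_colouring:
  assumes G: "simple_graph G" and c: "c ` verts G = {..<r}"
    and edge: "\<And>u v. u \<in> verts G \<Longrightarrow> v \<in> verts G \<Longrightarrow> {u, v} \<in> edges G \<longleftrightarrow> c u \<noteq> c v"
  shows "complete_partite r G"
proof -
  let ?A = "\<lambda>i. {v \<in> verts G. c v = i}"
  have ne: "?A i \<noteq> {}" if "i < r" for i
  proof -
    have "i \<in> c ` verts G" using c that by simp
    then show ?thesis by blast
  qed
  have cr: "c v < r" if "v \<in> verts G" for v using c that by auto
  have "partition_on (verts G) (?A ` {..<r})"
  proof (rule partition_onI)
    show "\<Union> (?A ` {..<r}) = verts G" using cr by auto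
    show "{} \<notin> ?A ` {..<r}" using ne by blast
  qed (auto simp: disjnt_def)
  moreover have "card (?A ` {..<r}) = r"
  proof -
    have "inj_on ?A {..<r}"
    proof (rule inj_onI)
      fix i j assume ij: "i \<in> {..<r}" "j \<in> {..<r}" "?A i = ?A j"
      then obtain v where "v \<in> ?A i" using ne[of i] by blast
      moreover from this ij have "v \<in> ?A j" by blast
      ultimately show "i = j" by simp
    qed
    then show ?thesis by (simp add: card_image)
  qed
  moreover have "edges G = {{u, v} | u v. \<exists>A\<in>?A ` {..<r}. \<exists>B\<in>?A ` {..<r}. A \<noteq> B \<and> u \<in> A \<and> v \<in> B}"
    (is "_ = ?E")
  proof (intro set_eqI iffI)
    fix e assume e: "e \<in> edges G"
    then obtain u v where uv: "e = {u, v}" "u \<in> verts G" "v \<in> verts G" using edge_cases[OF G] by metis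
    then have "c u \<noteq> c v" using e edge by simp
    then have A: "?A (c u) \<noteq> ?A (c v)" "u \<in> ?A (c u)" "v \<in> ?A (c v)" using uv by auto
    have P: "?A (c u) \<in> ?A ` {..<r}" "?A (c v) \<in> ?A ` {..<r}" using uv cr by simp_all
    have "\<exists>A\<in>P. \<exists>B\<in>P. A \<noteq> B \<and> u \<in> A \<and> v \<in> B"
      if "A \<in> P" "B \<in> P" "A \<noteq> B" "u \<in> A" "v \<in> B" for P A B
      using that by blast
    from this[OF P A] have "\<exists>A\<in>?A ` {..<r}. \<exists>B\<in>?A ` {..<r}. A \<noteq> B \<and> u \<in> A \<and> v \<in> B" .
    with uv(1) show "e \<in> ?E" unfolding mem_Collect_eq by (intro exI[of _ u] exI[of _ v] conjI)
  next
    fix e assume "e \<in> ?E"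
    then obtain u v i j where "e = {u, v}" "?A i \<noteq> ?A j" "u \<in> ?A i" "v \<in> ?A j" by blast
    moreover from this have "i \<noteq> j" by blast
    ultimately show "e \<in> edges G" using edge by simp
  qed
  ultimately show ?thesis unfolding complete_partite_def by blast
qed

lemma not_critical_if_st_free:
  assumes H: "simple_graph H" and G: "simple_graph G" "\<not> complete_graph G"
    and c: "c ` verts G \<subseteq> {..<r}"
    and edge: "\<And>u v. u \<in> verts G \<Longrightarrow> v \<in> verts G \<Longrightarrow> {u, v} \<in> edges G \<longleftrightarrow> c u \<noteq> c v"
    and free: "st_free H G"
  shows "\<not> has_critical H r (card (verts G))"
proof
  assume crit: "has_critical H r (card (verts G))"
  obtain u v where uv: "u \<in> verts G" "v \<in> verts G" "u \<noteq> v" "{u, v} \<notin> edges G"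
    using G(2) by (auto simp: complete_graph_def)
  then have same: "c u = c v" using edge by blast
  have fin: "finite (verts G)" using G(1) by (simp add: simple_graph_def)
  obtain f where f: "inj_on f (verts G)" "f ` verts G \<subseteq> verts H" "{f u, f v} \<in> edges H"
    "\<And>a b. a \<in> verts G \<Longrightarrow> b \<in> verts G \<Longrightarrow> c a \<noteq> c b \<Longrightarrow> {f a, f b} \<in> edges H"
    by (rule embed_critical[OF H crit fin le_refl c uv(1-3) same]) blast
  have "\<not> st_free H G"
  proof (rule not_st_free_if_embedding[OF H G(1) f(1,2) _ uv(1,2,4) f(3)])
    fix a b assume ab: "{a, b} \<in> edges G"
    note V = edge_in_verts(1,2)[OF G(1) ab]
    show "{f a, f b} \<in> edges H" using f(4)[OF V] edge[OF V] ab by blast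
  qed
  with free show False by blast
qed

lemma st_eq_ex_complete:
  assumes G: "simple_graph G" "\<not> complete_graph G" and D: "chromatic_number_D G = chromatic_number G + 1"
  shows "\<forall>\<^sub>F n in sequentially. st n G = ex n (complete_graph_on (chromatic_number G + 1))"
proof -
  let ?r = "chromatic_number G"
  obtain c where c: "c ` verts G = {..<?r}"
    and edge: "\<And>u v. u \<in> verts G \<Longrightarrow> v \<in> verts G \<Longrightarrow> {u, v} \<in> edges G \<longleftrightarrow> c u \<noteq> c v"
    using critical_colouring[OF G D] by metis
  obtain u where u: "u \<in> verts G" using G(2) by (auto simp: complete_graph_def)
  have "?r \<noteq> 0" using c u by (intro notI) auto
  then have r: "1 \<le> ?r" by simp
  obtain n1 where n1: "\<And>H :: nat graph. simple_graph H \<Longrightarrow> n1 \<le> card (verts H) \<Longrightarrow>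
      \<not> has_critical H ?r (card (verts G)) \<Longrightarrow> card (edges H) \<le> turan ?r (card (verts H))"
    using card_edges_le_turan_if_not_critical[OF r] by blast
  obtain n2 where n2: "\<And>H :: nat graph. simple_graph H \<Longrightarrow> n2 \<le> card (verts H) \<Longrightarrow>
      \<not> has_critical H ?r (Suc ?r) \<Longrightarrow> card (edges H) \<le> turan ?r (card (verts H))"
    using card_edges_le_turan_if_not_critical[OF r] by blast
  have st: "st n G = turan ?r n" if n: "n1 \<le> n" for n
  proof (rule antisym)
    obtain H :: "nat graph" where H: "simple_graph H" "card (verts H) = n" "st_free H G" "card (edges H) = st n G"
      using st_attained[OF G(1)] .
    have "\<not> has_critical H ?r (card (verts G))"
      using not_critical_if_st_free[OF H(1) G _ edge H(3)] c by simp
    then show "st n G \<le> turan ?r n" using n1[OF H(1)] H n by simp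
    show "turan ?r n \<le> st n G" using turan_le_st[OF G(1) r] D by simp
  qed
  have ex: "ex n (complete_graph_on (Suc ?r)) = turan ?r n" if n: "n2 \<le> n" for n
  proof (rule antisym)
    obtain H :: "nat graph" where H: "simple_graph H" "card (verts H) = n"
      "\<not> contains H (complete_graph_on (Suc ?r))" "card (edges H) = ex n (complete_graph_on (Suc ?r))"
      using ex_attained[OF complete_graph_on_edges_nonempty[of "Suc ?r"]] r by auto
    have "\<not> has_critical H ?r (Suc ?r)" using contains_complete_if_critical[OF H(1) r] H(3) by blast
    then show "ex n (complete_graph_on (Suc ?r)) \<le> turan ?r n" using n2[OF H(1)] H n by simp
  qed (rule turan_le_ex[OF r])
  show ?thesis
    using eventually_ge_at_top[of "max n1 n2"] by eventually_elim (simp add: st ex)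
qed

section \<open>Bipartite graphs\<close>

lemma st_le_ex:
  fixes H :: "nat graph"
  assumes G: "simple_graph G" and H: "simple_graph H" "card (verts H) = card (verts G)" "contains_proper H G"
  shows "st n G \<le> ex n H"
proof -
  obtain X :: "nat graph" where X: "simple_graph X" "card (verts X) = n" "st_free X G" "card (edges X) = st n G"
    using st_attained[OF G] .
  have "\<not> contains X H"
  proof
    assume "contains X H"
    then obtain H' g where H': "subgraph H' X" and g: "bij_betw g (verts H) (verts H')"
      and gE: "(\<lambda>e. g ` e) ` edges H = edges H'"
      unfolding contains_def graph_iso_def by blast
    obtain G' where G': "subgraph G' H" "G' \<noteq> H" "graph_iso G G'"
      using H(3) unfolding contains_proper_def by blast
    obtain f where f: "bij_betw f (verts G) (verts G')" "(\<lambda>e. f ` e) ` edges G = edges G'"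
      using G'(3) unfolding graph_iso_def by blast
    have "verts G' = verts H"
      using G'(1) H(1,2) bij_betw_same_card[OF f(1)]
      by (intro card_subset_eq) (auto simp: subgraph_def simple_graph_def)
    then have "edges G' \<noteq> edges H" using G'(2) by (auto simp: prod_eq_iff)
    then obtain e where e: "e \<in> edges H" "e \<notin> edges G'" using G'(1) by (auto simp: subgraph_def)
    let ?G'' = "(g ` verts G', (\<lambda>e. g ` e) ` edges G')"
    have g': "inj_on g (verts H)" "g ` verts H = verts H'" using g by (auto simp: bij_betw_def)
    have sG': "simple_graph G'" using G'(1) by (simp add: subgraph_def)
    have "(\<lambda>e. g ` e) ` edges G' \<subseteq> edges H'"
      unfolding gE[symmetric] using G'(1) by (intro image_mono) (simp add: subgraph_def)
    then have "subgraph ?G'' H'"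
      using simple_image[OF sG', of g] g' \<open>verts G' = verts H\<close> by (simp add: subgraph_def)
    moreover have "?G'' \<noteq> H'"
    proof
      assume "?G'' = H'"
      then have "edges ?G'' = edges H'" by (rule arg_cong)
      then have "g ` e \<in> (\<lambda>e. g ` e) ` edges G'" using e(1) gE by auto
      then obtain e' where e': "e' \<in> edges G'" "g ` e = g ` e'" by auto
      then have "e \<subseteq> verts H" "e' \<subseteq> verts H" using e(1) H(1) G'(1) by (auto simp: simple_graph_def subgraph_def)
      with e' have "e = e'" using inj_on_image_eq_iff[OF g'(1)] by blast
      with e e' show False by blast
    qed
    moreover have "graph_iso G ?G''"
      unfolding graph_iso_def
    proof (intro exI conjI)
      show "bij_betw (g \<circ> f) (verts G) (verts ?G'')"
        using bij_betw_trans[OF f(1), of g] inj_on_imp_bij_betw[of g "verts G'"] g'(1)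
          \<open>verts G' = verts H\<close> by simp
      show "(\<lambda>e. (g \<circ> f) ` e) ` edges G = edges ?G''"
        unfolding f(2)[symmetric] by (simp add: image_comp comp_def)
    qed
    ultimately have "contains_proper H' G"
      unfolding contains_proper_def by (intro exI[of _ ?G''] conjI)
    moreover have "card (verts H') = card (verts G)" using bij_betw_same_card[OF g] H(2) by simp
    ultimately show False using X(3) H' unfolding st_free_def by blast
  qed
  then show ?thesis using card_edges_le_ex[OF X(1,2)] X(4) by simp
qed

theorem theorem2:
  fixes G :: "'a graph"
  assumes "simple_graph G" and "\<not> complete_graph G"
  shows "(chromatic_number G \<ge> 3 \<and> chromatic_number_D G = chromatic_number G \<longrightarrow>
            (\<lambda>n. real (st n G)) \<sim>[sequentially] (\<lambda>n. real (ex n (complete_graph_on (chromatic_number G)))))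
       \<and> (chromatic_number_D G = chromatic_number G + 1 \<longrightarrow>
            complete_partite (chromatic_number G) G \<and>
            (\<forall>\<^sub>F n in sequentially. st n G = ex n (complete_graph_on (chromatic_number G + 1))))
       \<and> (chromatic_number G = 2 \<and> chromatic_number_D G = 2 \<longrightarrow>
            (\<forall>H :: nat graph. simple_graph H \<and> complete_partite 2 H \<and>
                card (verts H) = card (verts G) \<and> contains_proper H G \<longrightarrow>
                (\<forall>n \<ge> card (verts G). st n G \<le> ex n H)) \<and>
            (\<lambda>n. real (st n G)) \<in> o[sequentially](\<lambda>n. (real n)\<^sup>2))"
proof (intro conjI impI)
  assume *: "chromatic_number G \<ge> 3 \<and> chromatic_number_D G = chromatic_number G"
  define r where "r = chromatic_number G - 1"
  have r: "1 \<le> r" "1 < r" and Suc_r: "chromatic_number G = Suc r" using * unfolding r_def by linarith+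
  define L where "L = (1 - 1 / real r) / 2"
  have "L \<noteq> 0" using r by (simp add: L_def)
  have st: "(\<lambda>n. real (st n G) / (real n)\<^sup>2) \<longlonglongrightarrow> L"
    unfolding L_def using st_density[OF assms r(1)] * Suc_r by simp
  have ex: "(\<lambda>n. real (ex n (complete_graph_on (Suc r))) / (real n)\<^sup>2) \<longlonglongrightarrow> L"
    unfolding L_def by (rule ex_complete_density[OF r(1)])
  have "(\<lambda>n. (real (st n G) / (real n)\<^sup>2) / (real (ex n (complete_graph_on (Suc r))) / (real n)\<^sup>2))
      \<longlonglongrightarrow> L / L"
    by (rule tendsto_divide[OF st ex \<open>L \<noteq> 0\<close>])
  moreover have "\<forall>\<^sub>F n in sequentially.
      (real (st n G) / (real n)\<^sup>2) / (real (ex n (complete_graph_on (Suc r))) / (real n)\<^sup>2)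
      = real (st n G) / real (ex n (complete_graph_on (Suc r)))"
    using eventually_gt_at_top[of 0] by eventually_elim simp
  ultimately have "(\<lambda>n. real (st n G) / real (ex n (complete_graph_on (Suc r)))) \<longlonglongrightarrow> L / L"
    by (rule Lim_transform_eventually)
  then have "(\<lambda>n. real (st n G) / real (ex n (complete_graph_on (Suc r)))) \<longlonglongrightarrow> 1"
    using \<open>L \<noteq> 0\<close> by simp
  then show "(\<lambda>n. real (st n G)) \<sim>[sequentially] (\<lambda>n. real (ex n (complete_graph_on (chromatic_number G))))"
    unfolding Suc_r by (rule asymp_equivI')
next
  assume D: "chromatic_number_D G = chromatic_number G + 1"
  obtain c where "c ` verts G = {..<chromatic_number G}"
    "\<And>u v. u \<in> verts G \<Longrightarrow> v \<in> verts G \<Longrightarrow> {u, v} \<in> edges G \<longleftrightarrow> c u \<noteq> c v"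
    using critical_colouring[OF assms D] by metis
  then show "complete_partite (chromatic_number G) G"
    by (rule complete_partite_if_colouring[OF assms(1)])
  show "\<forall>\<^sub>F n in sequentially. st n G = ex n (complete_graph_on (chromatic_number G + 1))"
    by (rule st_eq_ex_complete[OF assms D])
next
  assume "chromatic_number G = 2 \<and> chromatic_number_D G = 2"
  then show "\<forall>H :: nat graph. simple_graph H \<and> complete_partite 2 H \<and>
      card (verts H) = card (verts G) \<and> contains_proper H G \<longrightarrow>
      (\<forall>n \<ge> card (verts G). st n G \<le> ex n H)"
    using st_le_ex[OF assms(1)] by blast
next
  assume "chromatic_number G = 2 \<and> chromatic_number_D G = 2"
  then have "(\<lambda>n. real (st n G) / (real n)\<^sup>2) \<longlonglongrightarrow> (1 - 1 / real 1) / 2"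
    by (intro st_density[OF assms]) auto
  then show "(\<lambda>n. real (st n G)) \<in> o[sequentially](\<lambda>n. (real n)\<^sup>2)"
    by (intro smalloI_tendsto) (auto intro: eventually_mono[OF eventually_gt_at_top[of 0]])
qed

end
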